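(* Let $M$ be an infinite metric space, let $f\colon M\to M$ be Lipschitz, and let $e\in M$. (i) If $f$ is weakly mixing, then $T_{f,e}\colon\mathcal F(M,e)\to\mathcal F(M,e)$ is weakly mixing. (ii) If $f$ is mixing, then $T_{f,e}$ is mixing. (iii) If $f$ is weakly mixing and chaotic, then $T_{f,e}$ is weakly mixing and chaotic.
   Context: $\mathbb K$ denotes $\mathbb R$ or $\mathbb C$. For a metric space $M$ and $e\in M$, $\mathrm{Lip}_0(M,e)$ is the Banach space of Lipschitz functions $\varphi\colon M\to\mathbb K$ with $\varphi(e)=0$, normed by the best Lipschitz constant. For $x\in M$, $\delta(x)=\delta_e(x)\in \mathrm{Lip}_0(M,e)^*$ is the evaluation functional $\varphi\mapsto\varphi(x)$. The Lipschitz-free space with basepoint $e$ is $\mathcal F(M,e):=\overline{\mathrm{span}}\{\delta(x):x\in M\}\subset \mathrm{Lip}_0(M,e)^*$ (norm closure). For a Lipschitz map $f\colon M\to M$ (not assumed to fix $e$), $T_{f,e}\colon\mathcal F(M,e)\to\mathcal F(M,e)$ is the unique bounded linear operator with $T_{f,e}(\delta(x))=\delta(f(x))-\delta(f(e))$ for all $x\in M$. A continuous self-map $g\colon N\to N$ of a metric space $N$ (in particular a bounded operator on a Banach space) is: topologically transitive if for all non-empty open $U,V\subset N$ there is $n\in\mathbb N\cup\{0\}$ with $g^n(U)\cap V\neq\emptyset$; weakly mixing if $g\times g$ is topologically transitive on $N\times N$; mixing if for all non-empty open $U,V\subset N$ there is $n_0\in\mathbb N$ with $g^n(U)\cap V\neq\emptyset$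 for all $n\ge n_0$; chaotic if it is topologically transitive and its set of periodic points is dense in $N$. *)

theory Defs
  imports "HOL-Analysis.Analysis" "HOL-Library.Function_Algebras"
begin

section \<open>Topological dynamics\<close>

definition topologically_transitive :: "'b topology \<Rightarrow> ('b \<Rightarrow> 'b) \<Rightarrow> bool" where
  "topologically_transitive X g \<longleftrightarrow> continuous_map X X g \<and>
     (\<forall>U V. openin X U \<and> U \<noteq> {} \<and> openin X V \<and> V \<noteq> {} \<longrightarrow>
        (\<exists>n. (g ^^ n) ` U \<inter> V \<noteq> {}))"

definition weakly_mixing :: "'b topology \<Rightarrow> ('b \<Rightarrow> 'b) \<Rightarrow> bool" where
  "weakly_mixing X g \<longleftrightarrow> continuous_map X X g \<and>
     topologically_transitive (prod_topology X X) (map_prod g g)"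

definition mixing :: "'b topology \<Rightarrow> ('b \<Rightarrow> 'b) \<Rightarrow> bool" where
  "mixing X g \<longleftrightarrow> continuous_map X X g \<and>
     (\<forall>U V. openin X U \<and> U \<noteq> {} \<and> openin X V \<and> V \<noteq> {} \<longrightarrow>
        (\<exists>n0. \<forall>n\<ge>n0. (g ^^ n) ` U \<inter> V \<noteq> {}))"

definition periodic_points :: "'b topology \<Rightarrow> ('b \<Rightarrow> 'b) \<Rightarrow> 'b set" where
  "periodic_points X g = {x \<in> topspace X. \<exists>n\<ge>1. (g ^^ n) x = x}"

definition chaotic :: "'b topology \<Rightarrow> ('b \<Rightarrow> 'b) \<Rightarrow> bool" where
  "chaotic X g \<longleftrightarrow> topologically_transitive X g \<and>
     X closure_of periodic_points X g = topspace X"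

section \<open>Lipschitz functions and the dual of \<open>Lip0\<close>\<close>

text \<open>The scalars are an arbitrary \<open>'k :: real_normed_field\<close>, to be instantiated with \<open>real\<close> and
  \<open>complex\<close>. Since the base point is a term, the spaces that depend on it are carrier
  sets inside function types; the vector operations are the pointwise ones
  of \<open>Function_Algebras\<close> together with \<open>fun_scale\<close>.\<close>

definition fun_scale :: "'k::real_normed_field \<Rightarrow> ('b \<Rightarrow> 'k) \<Rightarrow> 'b \<Rightarrow> 'k" where
  "fun_scale c F = (\<lambda>x. c * F x)"

definition Lip0 :: "'a::metric_space \<Rightarrow> ('a \<Rightarrow> 'k::real_normed_field) set" where
  "Lip0 e = {\<phi>. (\<exists>C. C-lipschitz_on UNIV \<phi>) \<and> \<phi> e = 0}"

definition lip_norm :: "('a::metric_space \<Rightarrow> 'k::real_normed_field) \<Rightarrow> real" where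
  "lip_norm \<phi> = Inf {C. C-lipschitz_on UNIV \<phi>}"

text \<open>A functional on \<open>Lip0 e\<close> is represented by its extension by \<open>0\<close> to all functions, so that
  equal functionals are equal terms and the carrier is closed under the pointwise operations.\<close>

definition Lip0_dual :: "'a::metric_space \<Rightarrow> (('a \<Rightarrow> 'k::real_normed_field) \<Rightarrow> 'k) set" where
  "Lip0_dual e = {\<Phi>.
     (\<forall>\<phi>. \<phi> \<notin> Lip0 e \<longrightarrow> \<Phi> \<phi> = 0) \<and>
     (\<forall>\<phi>\<in>Lip0 e. \<forall>\<psi>\<in>Lip0 e. \<Phi> (\<phi> + \<psi>) = \<Phi> \<phi> + \<Phi> \<psi>) \<and>
     (\<forall>c. \<forall>\<phi>\<in>Lip0 e. \<Phi> (fun_scale c \<phi>) = c * \<Phi> \<phi>) \<and>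
     (\<exists>B. \<forall>\<phi>\<in>Lip0 e. norm (\<Phi> \<phi>) \<le> B * lip_norm \<phi>)}"

definition dual_norm :: "'a::metric_space \<Rightarrow> (('a \<Rightarrow> 'k::real_normed_field) \<Rightarrow> 'k) \<Rightarrow> real" where
  "dual_norm e \<Phi> = Sup {norm (\<Phi> \<phi>) | \<phi>. \<phi> \<in> Lip0 e \<and> lip_norm \<phi> \<le> 1}"

text \<open>The guard is there because \<open>Metric_space\<close> asks for nonnegativity on the whole type, where
  the supremum above need not make sense.\<close>

definition dual_dist ::
  "'a::metric_space \<Rightarrow> (('a \<Rightarrow> 'k::real_normed_field) \<Rightarrow> 'k) \<Rightarrow> (('a \<Rightarrow> 'k) \<Rightarrow> 'k) \<Rightarrow> real" where
  "dual_dist e \<Phi> \<Psi> =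
     (if \<Phi> \<in> Lip0_dual e \<and> \<Psi> \<in> Lip0_dual e then dual_norm e (\<Phi> - \<Psi>) else 0)"

section \<open>The Lipschitz-free space\<close>

definition delta :: "'a::metric_space \<Rightarrow> 'a \<Rightarrow> ('a \<Rightarrow> 'k::real_normed_field) \<Rightarrow> 'k" where
  "delta e x = (\<lambda>\<phi>. if \<phi> \<in> Lip0 e then \<phi> x else 0)"

definition free_space :: "'a::metric_space \<Rightarrow> (('a \<Rightarrow> 'k::real_normed_field) \<Rightarrow> 'k) set" where
  "free_space e =
     Metric_space.mtopology (Lip0_dual e) (dual_dist e) closure_of
       module.span fun_scale (range (delta e))"

definition free_topology :: "'a::metric_space \<Rightarrow> (('a \<Rightarrow> 'k::real_normed_field) \<Rightarrow> 'k) topology" where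
  "free_topology e = Metric_space.mtopology (free_space e) (dual_dist e)"

text \<open>Bounded linear operators on the free space; the value outside the carrier is fixed
  (\<open>extensional\<close>) so that operators are determined by their values on the carrier.\<close>

definition free_operator ::
  "'a::metric_space \<Rightarrow> ((('a \<Rightarrow> 'k::real_normed_field) \<Rightarrow> 'k) \<Rightarrow> (('a \<Rightarrow> 'k) \<Rightarrow> 'k)) \<Rightarrow> bool" where
  "free_operator e T \<longleftrightarrow>
     T \<in> free_space e \<rightarrow>\<^sub>E free_space e \<and>
     (\<forall>\<Phi>\<in>free_space e. \<forall>\<Psi>\<in>free_space e. T (\<Phi> + \<Psi>) = T \<Phi> + T \<Psi>) \<and>
     (\<forall>c. \<forall>\<Phi>\<in>free_space e. T (fun_scale c \<Phi>) = fun_scale c (T \<Phi>)) \<and>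
     (\<exists>B. \<forall>\<Phi>\<in>free_space e. dual_norm e (T \<Phi>) \<le> B * dual_norm e \<Phi>)"

text \<open>The operator \<open>T\<^sub>f\<^sub>,\<^sub>e\<close>; see \<open>Lip_operator_unique_existence\<close> below for the
  justification of the definite description.\<close>

definition Lip_operator ::
  "('a::metric_space \<Rightarrow> 'a) \<Rightarrow> 'a \<Rightarrow> (('a \<Rightarrow> 'k::real_normed_field) \<Rightarrow> 'k) \<Rightarrow> (('a \<Rightarrow> 'k) \<Rightarrow> 'k)" where
  "Lip_operator f e =
     (THE T. free_operator e T \<and> (\<forall>x. T (delta e x) = delta e (f x) - delta e (f e)))"

section \<open>Well-definedness\<close>

global_interpretation fun_module: module "fun_scale :: 'k::real_normed_field \<Rightarrow> ('b \<Rightarrow> 'k) \<Rightarrow> _"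
  by unfold_locales (auto simp: fun_scale_def algebra_simps fun_eq_iff)

lemma fun_scale_apply: "fun_scale c F x = c * F x"
  by (simp add: fun_scale_def)

lemma lip_norm_le:
  assumes "C-lipschitz_on UNIV \<phi>" shows "lip_norm \<phi> \<le> C"
  unfolding lip_norm_def
  by (rule cInf_lower) (use assms in \<open>auto intro!: bdd_belowI[of _ 0] dest: lipschitz_on_nonneg\<close>)

lemma lip_norm_lipschitz:
  assumes "C-lipschitz_on UNIV \<phi>" shows "(lip_norm \<phi>)-lipschitz_on UNIV \<phi>"
proof (rule lipschitz_onI)
  show nonneg: "0 \<le> lip_norm \<phi>"
    unfolding lip_norm_def
    by (rule cInf_greatest) (use assms in \<open>auto dest: lipschitz_on_nonneg\<close>)
  fix x y
  show "dist (\<phi> x) (\<phi> y) \<le> lip_norm \<phi> * dist x y"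
  proof (cases "x = y")
    case False
    have "dist (\<phi> x) (\<phi> y) / dist x y \<le> lip_norm \<phi>"
      unfolding lip_norm_def
    proof (rule cInf_greatest)
      fix D assume "D \<in> {C. C-lipschitz_on UNIV \<phi>}"
      then have "dist (\<phi> x) (\<phi> y) \<le> D * dist x y"
        by (auto dest: lipschitz_onD)
      with False show "dist (\<phi> x) (\<phi> y) / dist x y \<le> D"
        by (simp add: divide_le_eq)
    qed (use assms in auto)
    with False show ?thesis by (simp add: divide_le_eq)
  qed simp
qed

lemma Lip0_lipschitz: "\<phi> \<in> Lip0 e \<Longrightarrow> (lip_norm \<phi>)-lipschitz_on UNIV \<phi>"
  by (auto simp: Lip0_def intro: lip_norm_lipschitz)

lemma lip_norm_nonneg: "\<phi> \<in> Lip0 e \<Longrightarrow> 0 \<le> lip_norm \<phi>"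
  using Lip0_lipschitz lipschitz_on_nonneg by blast

lemma Lip0_zero: "0 \<in> Lip0 e"
  by (auto simp: Lip0_def zero_fun_def intro: lipschitz_on_constant)

lemma Lip0_add: "\<phi> \<in> Lip0 e \<Longrightarrow> \<psi> \<in> Lip0 e \<Longrightarrow> \<phi> + \<psi> \<in> Lip0 e"
  by (auto simp: Lip0_def plus_fun_def intro: lipschitz_on_add)

lemma lipschitz_fun_scale:
  assumes "C-lipschitz_on UNIV \<phi>" shows "(norm c * C)-lipschitz_on UNIV (fun_scale c \<phi>)"
proof (rule lipschitz_onI)
  show "0 \<le> norm c * C" using lipschitz_on_nonneg[OF assms] by simp
  fix x y
  have "dist (\<phi> x) (\<phi> y) \<le> C * dist x y" using assms by (auto dest: lipschitz_onD)
  then have "norm c * dist (\<phi> x) (\<phi> y) \<le> norm c * (C * dist x y)"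
    by (rule mult_left_mono) simp
  then show "dist (fun_scale c \<phi> x) (fun_scale c \<phi> y) \<le> norm c * C * dist x y"
    by (simp add: dist_norm fun_scale_apply norm_mult mult.assoc flip: right_diff_distrib)
qed

lemma Lip0_scale: "\<phi> \<in> Lip0 e \<Longrightarrow> fun_scale c \<phi> \<in> Lip0 e"
  using lipschitz_fun_scale[of _ \<phi> c] by (auto simp: Lip0_def fun_scale_apply)

lemma lip_norm_scale_le: "\<phi> \<in> Lip0 e \<Longrightarrow> lip_norm (fun_scale c \<phi>) \<le> norm c * lip_norm \<phi>"
  by (intro lip_norm_le lipschitz_fun_scale Lip0_lipschitz)

lemma Lip0_dual_bound_nonneg:
  assumes "\<Phi> \<in> Lip0_dual e"
  obtains B where "B \<ge> 0" "\<And>\<phi>. \<phi> \<in> Lip0 e \<Longrightarrow> norm (\<Phi> \<phi>) \<le> B * lip_norm \<phi>"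
proof -
  obtain B where B: "\<And>\<phi>. \<phi> \<in> Lip0 e \<Longrightarrow> norm (\<Phi> \<phi>) \<le> B * lip_norm \<phi>"
    using assms unfolding Lip0_dual_def by blast
  show thesis
  proof (rule that[of "max B 0"])
    fix \<phi> :: "'a \<Rightarrow> 'b" assume "\<phi> \<in> Lip0 e"
    then have "B * lip_norm \<phi> \<le> max B 0 * lip_norm \<phi>"
      by (intro mult_right_mono lip_norm_nonneg) auto
    with B[OF \<open>\<phi> \<in> Lip0 e\<close>] show "norm (\<Phi> \<phi>) \<le> max B 0 * lip_norm \<phi>" by simp
  qed simp
qed

lemma dual_norm_le:
  assumes "\<And>\<phi>. \<phi> \<in> Lip0 e \<Longrightarrow> norm (\<Phi> \<phi>) \<le> B * lip_norm \<phi>" "B \<ge> 0"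
  shows "dual_norm e \<Phi> \<le> B"
  unfolding dual_norm_def
proof (rule cSup_least)
  have "lip_norm (0::'a \<Rightarrow> 'b) \<le> 0"
    by (rule lip_norm_le) (simp add: zero_fun_def lipschitz_on_constant)
  then have "lip_norm (0::'a \<Rightarrow> 'b) \<le> 1" by linarith
  with Lip0_zero[of e] show "{norm (\<Phi> \<phi>) |\<phi>. \<phi> \<in> Lip0 e \<and> lip_norm \<phi> \<le> 1} \<noteq> {}"
    by blast
next
  fix r assume "r \<in> {norm (\<Phi> \<phi>) |\<phi>. \<phi> \<in> Lip0 e \<and> lip_norm \<phi> \<le> 1}"
  then obtain \<phi> where \<phi>: "r = norm (\<Phi> \<phi>)" "\<phi> \<in> Lip0 e" "lip_norm \<phi> \<le> 1" by auto
  then have "B * lip_norm \<phi> \<le> B * 1" using assms(2) by (intro mult_left_mono)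
  with assms(1)[of \<phi>] \<phi> show "r \<le> B" by simp
qed

lemma norm_le_dual_norm_1:
  assumes "\<Phi> \<in> Lip0_dual e" "\<phi> \<in> Lip0 e" "lip_norm \<phi> \<le> 1"
  shows "norm (\<Phi> \<phi>) \<le> dual_norm e \<Phi>"
  unfolding dual_norm_def
proof (rule cSup_upper)
  obtain B where B: "B \<ge> 0" "\<And>\<phi>. \<phi> \<in> Lip0 e \<Longrightarrow> norm (\<Phi> \<phi>) \<le> B * lip_norm \<phi>"
    using Lip0_dual_bound_nonneg[OF assms(1)] by blast
  show "bdd_above {norm (\<Phi> \<phi>) |\<phi>. \<phi> \<in> Lip0 e \<and> lip_norm \<phi> \<le> 1}"
  proof (rule bdd_aboveI[of _ B])
    fix r assume "r \<in> {norm (\<Phi> \<phi>) |\<phi>. \<phi> \<in> Lip0 e \<and> lip_norm \<phi> \<le> 1}"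
    then obtain \<phi> where \<phi>: "r = norm (\<Phi> \<phi>)" "\<phi> \<in> Lip0 e" "lip_norm \<phi> \<le> 1" by auto
    then have "B * lip_norm \<phi> \<le> B * 1" using B by (intro mult_left_mono)
    with B(2)[of \<phi>] \<phi> show "r \<le> B" by simp
  qed
qed (use assms in auto)

lemma norm_le_dual_norm:
  assumes \<Phi>: "\<Phi> \<in> Lip0_dual e" and \<phi>: "\<phi> \<in> Lip0 e"
  shows "norm (\<Phi> \<phi>) \<le> dual_norm e \<Phi> * lip_norm \<phi>"
proof (cases "lip_norm \<phi> = 0")
  case True
  obtain B where "B \<ge> 0" "\<And>\<phi>. \<phi> \<in> Lip0 e \<Longrightarrow> norm (\<Phi> \<phi>) \<le> B * lip_norm \<phi>"
    using Lip0_dual_bound_nonneg[OF \<Phi>] by blast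
  with \<phi> True have "norm (\<Phi> \<phi>) \<le> 0" by fastforce
  with True show ?thesis by simp
next
  case False
  define L where "L = lip_norm \<phi>"
  have L: "L > 0" using False lip_norm_nonneg[OF \<phi>] by (simp add: L_def)
  define c :: 'b where "c = of_real (1 / L)"
  have nc: "norm c = 1 / L" using L by (simp add: c_def norm_divide)
  have "lip_norm (fun_scale c \<phi>) \<le> 1"
    using lip_norm_scale_le[OF \<phi>, of c] L nc by (simp add: L_def)
  then have "norm (\<Phi> (fun_scale c \<phi>)) \<le> dual_norm e \<Phi>"
    by (intro norm_le_dual_norm_1 \<Phi> Lip0_scale \<phi>)
  also have "\<Phi> (fun_scale c \<phi>) = c * \<Phi> \<phi>" using \<Phi> \<phi> by (simp add: Lip0_dual_def)
  finally show ?thesis using L nc by (simp add: norm_mult L_def field_simps)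
qed

lemma dual_norm_nonneg: 
  assumes "\<Phi> \<in> Lip0_dual e" shows "0 \<le> dual_norm e \<Phi>"
proof -
  have "lip_norm (0::'a \<Rightarrow> 'b) \<le> 0"
    by (rule lip_norm_le) (simp add: zero_fun_def lipschitz_on_constant)
  then have "lip_norm (0::'a \<Rightarrow> 'b) \<le> 1" by linarith
  then have "norm (\<Phi> 0) \<le> dual_norm e \<Phi>"
    by (intro norm_le_dual_norm_1 assms Lip0_zero)
  then show ?thesis by (rule order_trans[OF norm_ge_zero])
qed

lemma Lip0_dual_memI:
  assumes "\<And>\<phi>. \<phi> \<notin> Lip0 e \<Longrightarrow> \<Phi> \<phi> = 0"
    and "\<And>\<phi> \<psi>. \<phi> \<in> Lip0 e \<Longrightarrow> \<psi> \<in> Lip0 e \<Longrightarrow> \<Phi> (\<phi> + \<psi>) = \<Phi> \<phi> + \<Phi> \<psi>"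
    and "\<And>c \<phi>. \<phi> \<in> Lip0 e \<Longrightarrow> \<Phi> (fun_scale c \<phi>) = c * \<Phi> \<phi>"
    and "\<And>\<phi>. \<phi> \<in> Lip0 e \<Longrightarrow> norm (\<Phi> \<phi>) \<le> B * lip_norm \<phi>"
  shows "\<Phi> \<in> Lip0_dual e"
  using assms unfolding Lip0_dual_def by blast

lemma Lip0_dual_0: "0 \<in> Lip0_dual e"
  by (rule Lip0_dual_memI[where B = 0]) auto

lemma Lip0_dual_add:
  assumes "\<Phi> \<in> Lip0_dual e" "\<Psi> \<in> Lip0_dual e"
  shows "\<Phi> + \<Psi> \<in> Lip0_dual e"
proof (rule Lip0_dual_memI[where B = "dual_norm e \<Phi> + dual_norm e \<Psi>"])
  fix \<phi> :: "'a \<Rightarrow> 'b" assume "\<phi> \<in> Lip0 e"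
  from norm_le_dual_norm[OF assms(1) this] norm_le_dual_norm[OF assms(2) this]
  show "norm ((\<Phi> + \<Psi>) \<phi>) \<le> (dual_norm e \<Phi> + dual_norm e \<Psi>) * lip_norm \<phi>"
    using norm_triangle_ineq[of "\<Phi> \<phi>" "\<Psi> \<phi>"] by (simp add: distrib_right)
qed (use assms in \<open>auto simp: Lip0_dual_def algebra_simps\<close>)

lemma dual_norm_add_le:
  assumes "\<Phi> \<in> Lip0_dual e" "\<Psi> \<in> Lip0_dual e"
  shows "dual_norm e (\<Phi> + \<Psi>) \<le> dual_norm e \<Phi> + dual_norm e \<Psi>"
proof (rule dual_norm_le)
  fix \<phi> :: "'a \<Rightarrow> 'b" assume "\<phi> \<in> Lip0 e"
  from norm_le_dual_norm[OF assms(1) this] norm_le_dual_norm[OF assms(2) this]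
  show "norm ((\<Phi> + \<Psi>) \<phi>) \<le> (dual_norm e \<Phi> + dual_norm e \<Psi>) * lip_norm \<phi>"
    using norm_triangle_ineq[of "\<Phi> \<phi>" "\<Psi> \<phi>"] by (simp add: distrib_right)
qed (use assms dual_norm_nonneg in \<open>auto intro!: add_nonneg_nonneg\<close>)

lemma Lip0_dual_scale:
  assumes "\<Phi> \<in> Lip0_dual e" shows "fun_scale c \<Phi> \<in> Lip0_dual e"
proof (rule Lip0_dual_memI[where B = "norm c * dual_norm e \<Phi>"])
  fix \<phi> :: "'a \<Rightarrow> 'b" assume "\<phi> \<in> Lip0 e"
  from mult_left_mono[OF norm_le_dual_norm[OF assms this], of "norm c"]
  show "norm (fun_scale c \<Phi> \<phi>) \<le> norm c * dual_norm e \<Phi> * lip_norm \<phi>"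
    by (simp add: fun_scale_apply norm_mult mult.assoc)
qed (use assms in \<open>auto simp: Lip0_dual_def fun_scale_apply algebra_simps\<close>)

lemma dual_norm_scale_le:
  assumes "\<Phi> \<in> Lip0_dual e" shows "dual_norm e (fun_scale c \<Phi>) \<le> norm c * dual_norm e \<Phi>"
proof (rule dual_norm_le)
  fix \<phi> :: "'a \<Rightarrow> 'b" assume "\<phi> \<in> Lip0 e"
  from mult_left_mono[OF norm_le_dual_norm[OF assms this], of "norm c"]
  show "norm (fun_scale c \<Phi> \<phi>) \<le> norm c * dual_norm e \<Phi> * lip_norm \<phi>"
    by (simp add: fun_scale_apply norm_mult mult.assoc)
qed (use dual_norm_nonneg[OF assms] in simp)

lemma subspace_Lip0_dual: "fun_module.subspace (Lip0_dual e)"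
  by (auto simp: fun_module.subspace_def Lip0_dual_0 Lip0_dual_add Lip0_dual_scale)

lemmas Lip0_dual_diff = fun_module.subspace_diff[OF subspace_Lip0_dual]

lemma dual_norm_minus_commute: "dual_norm e (\<Phi> - \<Psi>) = dual_norm e (\<Psi> - \<Phi>)"
  unfolding dual_norm_def by (simp add: norm_minus_commute)

lemma dual_norm_eq_0D:
  assumes "\<Phi> \<in> Lip0_dual e" "dual_norm e \<Phi> = 0" shows "\<Phi> = 0"
proof
  fix \<phi>
  show "\<Phi> \<phi> = 0 \<phi>"
  proof (cases "\<phi> \<in> Lip0 e")
    case True
    with norm_le_dual_norm[OF assms(1) this] assms(2) show ?thesis by simp
  next
    case False
    with assms(1) show ?thesis by (simp add: Lip0_dual_def)
  qed
qed

lemma dual_norm_0: "dual_norm e 0 = 0"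
  by (intro order_antisym dual_norm_le dual_norm_nonneg Lip0_dual_0) auto

lemma Metric_space_dual: "Metric_space (Lip0_dual e) (dual_dist e)"
proof
  fix \<Phi> \<Psi> :: "('a \<Rightarrow> 'b) \<Rightarrow> 'b"
  show "0 \<le> dual_dist e \<Phi> \<Psi>"
    by (simp add: dual_dist_def dual_norm_nonneg Lip0_dual_diff)
  show "dual_dist e \<Phi> \<Psi> = dual_dist e \<Psi> \<Phi>"
    using dual_norm_minus_commute[of e \<Phi> \<Psi>] by (simp add: dual_dist_def)
next
  fix \<Phi> \<Psi> :: "('a \<Rightarrow> 'b) \<Rightarrow> 'b"
  assume \<Phi>: "\<Phi> \<in> Lip0_dual e" and \<Psi>: "\<Psi> \<in> Lip0_dual e"
  show "dual_dist e \<Phi> \<Psi> = 0 \<longleftrightarrow> \<Phi> = \<Psi>"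
    using dual_norm_eq_0D[OF Lip0_dual_diff[OF \<Phi> \<Psi>]] \<Phi> \<Psi> by (auto simp: dual_dist_def dual_norm_0)
  fix \<Theta> :: "('a \<Rightarrow> 'b) \<Rightarrow> 'b" assume \<Theta>: "\<Theta> \<in> Lip0_dual e"
  have "dual_norm e ((\<Phi> - \<Psi>) + (\<Psi> - \<Theta>)) \<le> dual_norm e (\<Phi> - \<Psi>) + dual_norm e (\<Psi> - \<Theta>)"
    by (intro dual_norm_add_le Lip0_dual_diff \<Phi> \<Psi> \<Theta>)
  then show "dual_dist e \<Phi> \<Theta> \<le> dual_dist e \<Phi> \<Psi> + dual_dist e \<Psi> \<Theta>"
    using \<Phi> \<Psi> \<Theta> by (simp add: dual_dist_def)
qed

lemma delta_in_dual: "delta e x \<in> Lip0_dual e"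
proof (rule Lip0_dual_memI[where B = "dist x e"])
  fix \<phi> :: "'a \<Rightarrow> 'b" assume \<phi>: "\<phi> \<in> Lip0 e"
  then have "dist (\<phi> x) (\<phi> e) \<le> lip_norm \<phi> * dist x e"
    using Lip0_lipschitz lipschitz_onD by blast
  with \<phi> show "norm (delta e x \<phi>) \<le> dist x e * lip_norm \<phi>"
    by (simp add: delta_def Lip0_def mult.commute)
qed (auto simp: delta_def Lip0_add Lip0_scale fun_scale_apply)

lemma delta_base: "delta e e = 0"
  by (auto simp: delta_def Lip0_def fun_eq_iff)

lemma span_delta_dual: "fun_module.span (range (delta e)) \<subseteq> Lip0_dual e"
  by (rule fun_module.span_minimal) (auto simp: delta_in_dual subspace_Lip0_dual)

lemma free_space_iff:
  "\<Phi> \<in> free_space e \<longleftrightarrow> \<Phi> \<in> Lip0_dual e \<and>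
     (\<forall>r>0. \<exists>\<Psi>\<in>fun_module.span (range (delta e)). dual_norm e (\<Phi> - \<Psi>) < r)"
proof -
  interpret Metric_space "Lip0_dual e :: (('a \<Rightarrow> 'b) \<Rightarrow> 'b) set" "dual_dist e"
    by (rule Metric_space_dual)
  show ?thesis
    unfolding free_space_def metric_closure_of using span_delta_dual[of e]
    by (fastforce simp: dual_dist_def)
qed

lemma free_space_dual: "\<Phi> \<in> free_space e \<Longrightarrow> \<Phi> \<in> Lip0_dual e"
  by (simp add: free_space_iff)

lemma span_free_space: "fun_module.span (range (delta e)) \<subseteq> free_space e"
proof
  fix \<Phi> assume "\<Phi> \<in> fun_module.span (range (delta e))"
  with span_delta_dual show "\<Phi> \<in> free_space e"
    by (auto simp: free_space_iff dual_norm_0 intro!: bexI[of _ \<Phi>])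
qed

lemma delta_free_space: "delta e x \<in> free_space e"
  using span_free_space fun_module.span_base by blast

lemma Metric_space_free: "Metric_space (free_space e) (dual_dist e)"
  using Metric_space.subspace[OF Metric_space_dual] free_space_dual by blast

lemma subspace_free_space:
  "fun_module.subspace (free_space e :: (('a::metric_space \<Rightarrow> 'b::real_normed_field) \<Rightarrow> 'b) set)"
  unfolding fun_module.subspace_def
proof (intro conjI ballI allI)
  show "0 \<in> free_space e" using span_free_space fun_module.span_zero by blast
next
  fix \<Phi> \<Psi> :: "('a \<Rightarrow> 'b) \<Rightarrow> 'b" assume \<Phi>: "\<Phi> \<in> free_space e" and \<Psi>: "\<Psi> \<in> free_space e"
  show "\<Phi> + \<Psi> \<in> free_space e"
    unfolding free_space_iff
  proof (intro conjI allI impI)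
    show "\<Phi> + \<Psi> \<in> Lip0_dual e" by (intro Lip0_dual_add free_space_dual \<Phi> \<Psi>)
    fix r :: real assume "r > 0"
    then obtain \<Phi>' \<Psi>' where *:
      "\<Phi>' \<in> fun_module.span (range (delta e))" "dual_norm e (\<Phi> - \<Phi>') < r / 2"
      "\<Psi>' \<in> fun_module.span (range (delta e))" "dual_norm e (\<Psi> - \<Psi>') < r / 2"
      using \<Phi> \<Psi> half_gt_zero unfolding free_space_iff by meson
    have "dual_norm e ((\<Phi> - \<Phi>') + (\<Psi> - \<Psi>')) \<le> dual_norm e (\<Phi> - \<Phi>') + dual_norm e (\<Psi> - \<Psi>')"
      using * span_free_space by (intro dual_norm_add_le Lip0_dual_diff free_space_dual \<Phi> \<Psi>) blast+
    also have "(\<Phi> - \<Phi>') + (\<Psi> - \<Psi>') = (\<Phi> + \<Psi>) - (\<Phi>' + \<Psi>')" by (simp add: algebra_simps)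
    finally have "dual_norm e ((\<Phi> + \<Psi>) - (\<Phi>' + \<Psi>')) < r" using * by linarith
    moreover have "\<Phi>' + \<Psi>' \<in> fun_module.span (range (delta e))"
      using * by (intro fun_module.span_add)
    ultimately show "\<exists>\<Theta>\<in>fun_module.span (range (delta e)). dual_norm e (\<Phi> + \<Psi> - \<Theta>) < r"
      by blast
  qed
next
  fix c :: 'b and \<Phi> :: "('a \<Rightarrow> 'b) \<Rightarrow> 'b" assume \<Phi>: "\<Phi> \<in> free_space e"
  show "fun_scale c \<Phi> \<in> free_space e"
    unfolding free_space_iff
  proof (intro conjI allI impI)
    show "fun_scale c \<Phi> \<in> Lip0_dual e" by (intro Lip0_dual_scale free_space_dual \<Phi>)
    fix r :: real assume "r > 0"
    define s where "s = r / (norm c + 1)"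
    have c1: "norm c + 1 > 0" by (rule add_nonneg_pos) auto
    have s: "s > 0" "norm c * s < r" using \<open>r > 0\<close> c1 by (auto simp: s_def field_simps)
    then obtain \<Phi>' where *:
      "\<Phi>' \<in> fun_module.span (range (delta e))" "dual_norm e (\<Phi> - \<Phi>') < s"
      using \<Phi> unfolding free_space_iff by meson
    have "dual_norm e (fun_scale c (\<Phi> - \<Phi>')) \<le> norm c * dual_norm e (\<Phi> - \<Phi>')"
      using * span_free_space by (intro dual_norm_scale_le Lip0_dual_diff free_space_dual \<Phi>) blast+
    also have "\<dots> \<le> norm c * s" using * by (intro mult_left_mono) auto
    also have "\<dots> < r" by (rule s)
    finally have "dual_norm e (fun_scale c \<Phi> - fun_scale c \<Phi>') < r"
      by (simp add: fun_module.scale_right_diff_distrib)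
    moreover have "fun_scale c \<Phi>' \<in> fun_module.span (range (delta e))"
      using * by (intro fun_module.span_scale)
    ultimately show "\<exists>\<Theta>\<in>fun_module.span (range (delta e)). dual_norm e (fun_scale c \<Phi> - \<Theta>) < r"
      by blast
  qed
qed

lemmas free_space_diff = fun_module.subspace_diff[OF subspace_free_space]

text \<open>Existence: precomposition with \<open>\<phi> \<mapsto> \<phi> \<circ> f - \<phi> (f e)\<close> on \<open>Lip0 e\<close>.\<close>

definition pull :: "('a::metric_space \<Rightarrow> 'a) \<Rightarrow> 'a \<Rightarrow> ('a \<Rightarrow> 'k::real_normed_field) \<Rightarrow> 'a \<Rightarrow> 'k" where
  "pull f e \<phi> = (\<lambda>x. \<phi> (f x) - \<phi> (f e))"

definition push ::
  "('a::metric_space \<Rightarrow> 'a) \<Rightarrow> 'a \<Rightarrow> (('a \<Rightarrow> 'k::real_normed_field) \<Rightarrow> 'k) \<Rightarrow> (('a \<Rightarrow> 'k) \<Rightarrow> 'k)" where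
  "push f e \<Phi> = (\<lambda>\<phi>. if \<phi> \<in> Lip0 e then \<Phi> (pull f e \<phi>) else 0)"

context
  fixes f :: "'a::metric_space \<Rightarrow> 'a" and C :: real
  assumes f: "C-lipschitz_on UNIV f"
begin

lemma pull_lipschitz:
  fixes \<phi> :: "'a \<Rightarrow> 'k::real_normed_field"
  assumes "\<phi> \<in> Lip0 e" shows "(C * lip_norm \<phi>)-lipschitz_on UNIV (pull f e \<phi>)"
proof (rule lipschitz_onI)
  show "0 \<le> C * lip_norm \<phi>"
    using lipschitz_on_nonneg[OF f] lip_norm_nonneg[OF assms] by simp
  fix x y
  have "dist (\<phi> (f x)) (\<phi> (f y)) \<le> lip_norm \<phi> * dist (f x) (f y)"
    using Lip0_lipschitz[OF assms] by (auto dest: lipschitz_onD)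
  also have "\<dots> \<le> lip_norm \<phi> * (C * dist x y)"
    using f lip_norm_nonneg[OF assms] by (auto dest: lipschitz_onD intro!: mult_left_mono)
  finally show "dist (pull f e \<phi> x) (pull f e \<phi> y) \<le> C * lip_norm \<phi> * dist x y"
    by (simp add: pull_def dist_norm mult_ac)
qed

lemma pull_Lip0: "\<phi> \<in> Lip0 e \<Longrightarrow> pull f e \<phi> \<in> Lip0 e"
  using pull_lipschitz[of \<phi> e] by (auto simp: Lip0_def pull_def)

lemma push_bound:
  assumes "\<Phi> \<in> Lip0_dual e" "\<phi> \<in> Lip0 e"
  shows "norm (push f e \<Phi> \<phi>) \<le> C * dual_norm e \<Phi> * lip_norm \<phi>"
proof -
  have "norm (\<Phi> (pull f e \<phi>)) \<le> dual_norm e \<Phi> * lip_norm (pull f e \<phi>)"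
    by (intro norm_le_dual_norm assms pull_Lip0)
  also have "\<dots> \<le> dual_norm e \<Phi> * (C * lip_norm \<phi>)"
    by (intro mult_left_mono lip_norm_le pull_lipschitz assms dual_norm_nonneg)
  finally show ?thesis using assms by (simp add: push_def mult_ac)
qed

lemma push_dual: assumes "\<Phi> \<in> Lip0_dual e" shows "push f e \<Phi> \<in> Lip0_dual e"
proof (rule Lip0_dual_memI)
  fix \<phi> \<psi> :: "'a \<Rightarrow> 'b" assume *: "\<phi> \<in> Lip0 e" "\<psi> \<in> Lip0 e"
  have "pull f e (\<phi> + \<psi>) = pull f e \<phi> + pull f e \<psi>" by (auto simp: pull_def fun_eq_iff)
  with * assms show "push f e \<Phi> (\<phi> + \<psi>) = push f e \<Phi> \<phi> + push f e \<Phi> \<psi>"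
    using pull_Lip0[OF *(1)] pull_Lip0[OF *(2)] Lip0_add[OF *]
    unfolding push_def Lip0_dual_def by simp
next
  fix c :: 'b and \<phi> :: "'a \<Rightarrow> 'b" assume *: "\<phi> \<in> Lip0 e"
  have "pull f e (fun_scale c \<phi>) = fun_scale c (pull f e \<phi>)"
    by (auto simp: pull_def fun_eq_iff fun_scale_apply algebra_simps)
  with * assms show "push f e \<Phi> (fun_scale c \<phi>) = c * push f e \<Phi> \<phi>"
    using pull_Lip0[OF *] Lip0_scale[OF *] unfolding push_def Lip0_dual_def by simp
next
  show "norm (push f e \<Phi> \<phi>) \<le> C * dual_norm e \<Phi> * lip_norm \<phi>" if "\<phi> \<in> Lip0 e" for \<phi>
    using push_bound[OF assms that] .
qed (simp add: push_def)

lemma push_norm_le: "\<Phi> \<in> Lip0_dual e \<Longrightarrow> dual_norm e (push f e \<Phi>) \<le> C * dual_norm e \<Phi>"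
  using lipschitz_on_nonneg[OF f]
  by (intro dual_norm_le push_bound mult_nonneg_nonneg dual_norm_nonneg)

lemma push_add: "push f e (\<Phi> + \<Psi>) = push f e \<Phi> + push f e \<Psi>"
  and push_diff: "push f e (\<Phi> - \<Psi>) = push f e \<Phi> - push f e \<Psi>"
  and push_scale: "push f e (fun_scale c \<Phi>) = fun_scale c (push f e \<Phi>)"
  by (auto simp: push_def fun_eq_iff fun_scale_apply)

lemma push_delta: "push f e (delta e x) = delta e (f x) - delta e (f e)"
  by (auto simp: push_def delta_def fun_eq_iff pull_Lip0) (auto simp: pull_def)

lemma push_span:
  assumes "\<Phi> \<in> fun_module.span (range (delta e))"
  shows "push f e \<Phi> \<in> fun_module.span (range (delta e))"
  using assms
proof (induction rule: fun_module.span_induct_alt)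
  case base
  have "push f e 0 = 0" by (auto simp: push_def fun_eq_iff)
  then show ?case using fun_module.span_zero by metis
next
  case (step c x y)
  then obtain z where x: "x = delta e z" by blast
  have "push f e (fun_scale c x + y) = fun_scale c (delta e (f z) - delta e (f e)) + push f e y"
    by (simp only: push_add push_scale push_delta x)
  moreover have "\<dots> \<in> fun_module.span (range (delta e))"
    by (intro fun_module.span_add fun_module.span_scale fun_module.span_diff fun_module.span_base
        step rangeI)
  ultimately show ?case by (simp only:)
qed

lemma push_free_space: assumes "\<Phi> \<in> free_space e" shows "push f e \<Phi> \<in> free_space e"
  unfolding free_space_iff
proof (intro conjI allI impI)
  show "push f e \<Phi> \<in> Lip0_dual e" by (intro push_dual free_space_dual assms)
  fix r :: real assume "r > 0"
  have C: "C \<ge> 0" using f lipschitz_on_nonneg by blast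
  define s where "s = r / (C + 1)"
  have s: "s > 0" "C * s < r" using \<open>r > 0\<close> C by (auto simp: s_def field_simps)
  then obtain \<Psi> where *: "\<Psi> \<in> fun_module.span (range (delta e))" "dual_norm e (\<Phi> - \<Psi>) < s"
    using assms unfolding free_space_iff by meson
  have "dual_norm e (push f e (\<Phi> - \<Psi>)) \<le> C * dual_norm e (\<Phi> - \<Psi>)"
    using * span_free_space by (intro push_norm_le Lip0_dual_diff free_space_dual assms) blast+
  also have "\<dots> \<le> C * s" using * C by (intro mult_left_mono) auto
  also have "\<dots> < r" by (rule s)
  finally have "dual_norm e (push f e \<Phi> - push f e \<Psi>) < r" by (simp add: push_diff)
  with push_span[OF *(1)]
  show "\<exists>\<Theta>\<in>fun_module.span (range (delta e)). dual_norm e (push f e \<Phi> - \<Theta>) < r" by blast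
qed

lemma free_operator_diff:
  assumes "free_operator e T" "\<Phi> \<in> free_space e" "\<Psi> \<in> free_space e"
  shows "T (\<Phi> - \<Psi>) = T \<Phi> - T \<Psi>"
proof -
  have "T ((\<Phi> - \<Psi>) + \<Psi>) = T (\<Phi> - \<Psi>) + T \<Psi>"
    using assms free_space_diff[OF assms(2,3)] unfolding free_operator_def by blast
  then show ?thesis by simp
qed

lemma free_operator_bound:
  fixes e :: 'a and T :: "(('a \<Rightarrow> 'k::real_normed_field) \<Rightarrow> 'k) \<Rightarrow> _"
  assumes "free_operator e T"
  obtains B where "B \<ge> 0" "\<And>\<Phi>. \<Phi> \<in> free_space e \<Longrightarrow> dual_norm e (T \<Phi>) \<le> B * dual_norm e \<Phi>"
proof -
  obtain B where B: "\<And>\<Phi>. \<Phi> \<in> free_space e \<Longrightarrow> dual_norm e (T \<Phi>) \<le> B * dual_norm e \<Phi>"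
    using assms unfolding free_operator_def by blast
  show thesis
  proof (rule that[of "max B 0"])
    fix \<Phi> :: "('a \<Rightarrow> 'k) \<Rightarrow> 'k" assume \<Phi>: "\<Phi> \<in> free_space e"
    then have "B * dual_norm e \<Phi> \<le> max B 0 * dual_norm e \<Phi>"
      by (intro mult_right_mono dual_norm_nonneg free_space_dual) auto
    with B[OF \<Phi>] show "dual_norm e (T \<Phi>) \<le> max B 0 * dual_norm e \<Phi>" by simp
  qed simp
qed

lemma free_operator_eqI:
  fixes e :: 'a and S T :: "(('a \<Rightarrow> 'k::real_normed_field) \<Rightarrow> 'k) \<Rightarrow> _"
  assumes S: "free_operator e S" and T: "free_operator e T"
    and eq: "\<And>x. S (delta e x) = T (delta e x)"
  shows "S = T"
proof (rule extensionalityI)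
  show "S \<in> extensional (free_space e)" "T \<in> extensional (free_space e)"
    using S T by (auto simp: free_operator_def PiE_def)
  have mem: "S \<Phi> \<in> Lip0_dual e" "T \<Phi> \<in> Lip0_dual e" if "\<Phi> \<in> free_space e" for \<Phi>
    using S T that by (auto simp: free_operator_def intro: free_space_dual)
  have span: "S \<Phi> = T \<Phi>" if "\<Phi> \<in> fun_module.span (range (delta e))" for \<Phi>
  proof -
    have "\<Phi> \<in> fun_module.span (range (delta e)) \<and> S \<Phi> = T \<Phi>"
      using that
    proof (induction rule: fun_module.span_induct_alt)
      case base
      then show ?case using eq[of e] fun_module.span_zero by (metis delta_base)
    next
      case (step c x y)
      have x: "x \<in> free_space e" and y: "y \<in> free_space e"
        and eqx: "S x = T x"
        using step span_free_space delta_free_space eq by blast+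
      have cx: "fun_scale c x \<in> free_space e"
        by (rule fun_module.subspace_scale[OF subspace_free_space x])
      have "S (fun_scale c x + y) = fun_scale c (S x) + S y"
        using S x y cx unfolding free_operator_def by simp
      moreover have "T (fun_scale c x + y) = fun_scale c (T x) + T y"
        using T x y cx unfolding free_operator_def by simp
      ultimately show ?case
        using step eqx fun_module.span_add fun_module.span_scale fun_module.span_base by metis
    qed
    then show ?thesis by blast
  qed
  fix \<Phi> :: "('a \<Rightarrow> 'k) \<Rightarrow> 'k" assume \<Phi>: "\<Phi> \<in> free_space e"
  obtain A where A: "A \<ge> 0" "\<And>\<Phi>. \<Phi> \<in> free_space e \<Longrightarrow> dual_norm e (S \<Phi>) \<le> A * dual_norm e \<Phi>"
    using free_operator_bound[OF S] by blast
  obtain B where B: "B \<ge> 0" "\<And>\<Phi>. \<Phi> \<in> free_space e \<Longrightarrow> dual_norm e (T \<Phi>) \<le> B * dual_norm e \<Phi>"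
    using free_operator_bound[OF T] by blast
  have "dual_norm e (S \<Phi> - T \<Phi>) \<le> 0 + r" if "r > 0" for r
  proof -
    define s where "s = r / (A + B + 1)"
    have s: "s > 0" "(A + B) * s \<le> r"
      using that A B by (auto simp: s_def field_simps intro!: divide_pos_pos)
    obtain \<Psi> where *: "\<Psi> \<in> fun_module.span (range (delta e))" "dual_norm e (\<Phi> - \<Psi>) < s"
      using \<Phi> s unfolding free_space_iff by meson
    have \<Psi>: "\<Psi> \<in> free_space e" using * span_free_space by blast
    note D = free_space_diff[OF \<Phi> \<Psi>]
    have split: "S \<Phi> - T \<Phi> = S (\<Phi> - \<Psi>) + (0 - T (\<Phi> - \<Psi>))"
      using span[OF *(1)] by (simp add: free_operator_diff[OF S \<Phi> \<Psi>] free_operator_diff[OF T \<Phi> \<Psi>])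
    have neg: "dual_norm e (0 - T (\<Phi> - \<Psi>)) = dual_norm e (T (\<Phi> - \<Psi>))"
      using dual_norm_minus_commute[of e 0 "T (\<Phi> - \<Psi>)"] by (simp only: diff_0_right)
    have "dual_norm e (S \<Phi> - T \<Phi>) \<le> dual_norm e (S (\<Phi> - \<Psi>)) + dual_norm e (T (\<Phi> - \<Psi>))"
      unfolding split neg[symmetric] by (intro dual_norm_add_le Lip0_dual_diff mem D Lip0_dual_0)
    also have "\<dots> \<le> (A + B) * dual_norm e (\<Phi> - \<Psi>)"
      unfolding distrib_right by (intro add_mono A(2)[OF D] B(2)[OF D])
    also have "\<dots> \<le> (A + B) * s" using * A B by (intro mult_left_mono) auto
    also have "\<dots> \<le> r" by (rule s)
    finally show ?thesis by simp
  qed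
  then have "dual_norm e (S \<Phi> - T \<Phi>) \<le> 0" by (rule field_le_epsilon)
  moreover have D: "S \<Phi> - T \<Phi> \<in> Lip0_dual e" by (intro Lip0_dual_diff mem \<Phi>)
  ultimately have "S \<Phi> - T \<Phi> = 0"
    using dual_norm_nonneg[OF D] by (intro dual_norm_eq_0D[OF D]) simp
  then show "S \<Phi> = T \<Phi>" by simp
qed

lemma Lip_operator_unique_existence:
  "\<exists>!T :: (('a \<Rightarrow> 'k::real_normed_field) \<Rightarrow> 'k) \<Rightarrow> _.
     free_operator e T \<and> (\<forall>x. T (delta e x) = delta e (f x) - delta e (f e))"
proof (rule ex_ex1I)
  define T :: "(('a \<Rightarrow> 'k) \<Rightarrow> 'k) \<Rightarrow> _" where "T = restrict (push f e) (free_space e)"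
  have "free_operator e T"
    unfolding free_operator_def
  proof (intro conjI)
    show "\<exists>B. \<forall>\<Phi>\<in>free_space e. dual_norm e (T \<Phi>) \<le> B * dual_norm e \<Phi>"
      by (intro exI[of _ C]) (auto simp: T_def push_norm_le free_space_dual)
  qed (use subspace_free_space[of e] in
        \<open>auto simp: T_def push_free_space push_add push_scale fun_module.subspace_def\<close>)
  moreover have "T (delta e x) = delta e (f x) - delta e (f e)" for x
    by (simp add: T_def delta_free_space push_delta)
  ultimately show "\<exists>T :: (('a \<Rightarrow> 'k) \<Rightarrow> 'k) \<Rightarrow> _.
    free_operator e T \<and> (\<forall>x. T (delta e x) = delta e (f x) - delta e (f e))"
    by (intro exI[of _ T] conjI allI)
next
  fix S T :: "(('a \<Rightarrow> 'k) \<Rightarrow> 'k) \<Rightarrow> _"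
  assume "free_operator e S \<and> (\<forall>x. S (delta e x) = delta e (f x) - delta e (f e))"
    and "free_operator e T \<and> (\<forall>x. T (delta e x) = delta e (f x) - delta e (f e))"
  then show "S = T" by (intro free_operator_eqI) auto
qed

lemmas Lip_operator_spec = theI'[OF Lip_operator_unique_existence, folded Lip_operator_def]

end

end

theory Submission
  imports Defs
begin

text \<open>Call a filter on the natural numbers adapted to \<open>g\<close> if, along it, the iterates of every
  nonempty open set eventually meet every other one. Weak mixing means (Furstenberg) that a proper
  adapted filter exists, and mixing that \<open>sequentially\<close> is adapted, so both statements follow once
  a filter adapted to \<open>f\<close> is shown to be adapted to \<open>T = T\<^sub>f\<^sub>,\<^sub>e\<close>.

  For that, consider the pairs \<open>(\<Phi>, \<Psi>)\<close> such that eventually some \<open>\<Theta>\<close> close to \<open>\<Phi>\<close> has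
  \<open>T\<^sup>n \<Theta>\<close> close to \<open>\<Psi>\<close>. They form a closed subspace. It contains \<open>(\<delta>(x), 0)\<close>: move \<open>x\<close> and \<open>e\<close>
  slightly to points \<open>y\<close> and \<open>z\<close> which \<open>f\<^sup>n\<close> sends close to one common point; then
  \<open>T\<^sup>n (\<delta>(y) - \<delta>(z)) = \<delta>(f\<^sup>n y) - \<delta>(f\<^sup>n z)\<close> is small. Symmetrically it contains \<open>(0, \<delta>(x))\<close>,
  hence it is everything.

  The periodic points of \<open>T\<close> form a subspace, which contains \<open>\<delta>(p) - \<delta>(q)\<close> for periodic \<open>p\<close>, \<open>q\<close>;
  if these are dense in \<open>M\<close>, the closure contains \<open>\<delta>(x) - \<delta>(e) = \<delta>(x)\<close> for all \<open>x\<close>.\<close>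

section \<open>Adapted filters and periods\<close>

text \<open>Properness is not built in: \<open>bot\<close> is adapted to every map, so
  \<open>F \<noteq> bot\<close> appears as a separate condition wherever an actual time must be
  extracted.\<close>

definition adapted_filter :: "'b topology \<Rightarrow> ('b \<Rightarrow> 'b) \<Rightarrow> nat filter \<Rightarrow> bool" where
  "adapted_filter X g F \<longleftrightarrow> (\<forall>U V. openin X U \<and> U \<noteq> {} \<and> openin X V \<and> V \<noteq> {} \<longrightarrow>
     (\<forall>\<^sub>F n in F. (g ^^ n) ` U \<inter> V \<noteq> {}))"

lemma mixing_iff_adapted:
  "mixing X g \<longleftrightarrow> continuous_map X X g \<and> adapted_filter X g sequentially"
  by (simp add: mixing_def adapted_filter_def eventually_sequentially)

lemma funpow_map_prod:
  fixes g :: "'a \<Rightarrow> 'a" and h :: "'b \<Rightarrow> 'b"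
  shows "map_prod g h ^^ n = map_prod (g ^^ n) (h ^^ n)"
  by (induction n) (auto simp: fun_eq_iff)

lemma continuous_map_funpow:
  assumes "continuous_map X X g" shows "continuous_map X X (g ^^ n)"
proof (induction n)
  case (Suc n)
  then show ?case using continuous_map_compose[OF _ assms] by (simp add: o_def)
qed simp

section \<open>Furstenberg's filter of hitting times of a weakly mixing map\<close>

lemma weakly_mixing_common_time:
  assumes "weakly_mixing X g"
    and "openin X U" "U \<noteq> {}" "openin X V" "V \<noteq> {}"
    and "openin X U'" "U' \<noteq> {}" "openin X V'" "V' \<noteq> {}"
  shows "\<exists>n. (g ^^ n) ` U \<inter> V \<noteq> {} \<and> (g ^^ n) ` U' \<inter> V' \<noteq> {}"
proof -
  have "openin (prod_topology X X) (U \<times> U')" "U \<times> U' \<noteq> {}"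
    "openin (prod_topology X X) (V \<times> V')" "V \<times> V' \<noteq> {}"
    using assms by (auto simp: openin_prod_Times_iff)
  then obtain n where "(map_prod g g ^^ n) ` (U \<times> U') \<inter> (V \<times> V') \<noteq> {}"
    using assms(1) unfolding weakly_mixing_def topologically_transitive_def by meson
  then show ?thesis by (auto simp: funpow_map_prod)
qed

text \<open>Furstenberg's intersection lemma: the hitting-time sets of pairs of open sets form a
  filter base. Pull \<open>U'\<close> and \<open>V'\<close> back by one common iterate
  \<open>g ^^ m\<close> and intersect with \<open>U\<close> and \<open>V\<close>; since iterates of
  \<open>g\<close> commute, a time that takes \<open>A\<close> to \<open>B\<close> serves both given
  pairs.\<close>

lemma weakly_mixing_refine:
  assumes wm: "weakly_mixing X g"
    and U: "openin X U" "U \<noteq> {}" and V: "openin X V" "V \<noteq> {}"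
    and U': "openin X U'" "U' \<noteq> {}" and V': "openin X V'" "V' \<noteq> {}"
  shows "\<exists>A B. openin X A \<and> A \<noteq> {} \<and> openin X B \<and> B \<noteq> {} \<and>
    (\<forall>n. (g ^^ n) ` A \<inter> B \<noteq> {} \<longrightarrow> (g ^^ n) ` U \<inter> V \<noteq> {} \<and> (g ^^ n) ` U' \<inter> V' \<noteq> {})"
proof -
  \<comment> \<open>The pairing is crossed: \<open>U\<close> has to meet \<open>U'\<close> and
    \<open>V\<close> has to meet \<open>V'\<close> at the same time \<open>m\<close>, which is
    exactly what makes \<open>A\<close> and \<open>B\<close> below non-empty.\<close>
  obtain m where m: "(g ^^ m) ` U \<inter> U' \<noteq> {}" "(g ^^ m) ` V \<inter> V' \<noteq> {}"
    using weakly_mixing_common_time[OF wm U U' V V'] by blast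
  have cont: "continuous_map X X (g ^^ m)"
    using wm by (simp add: weakly_mixing_def continuous_map_funpow)
  define A where "A = U \<inter> {x \<in> topspace X. (g ^^ m) x \<in> U'}"
  define B where "B = V \<inter> {x \<in> topspace X. (g ^^ m) x \<in> V'}"
  have "openin X A" "openin X B"
    unfolding A_def B_def
    by (intro openin_Int U V openin_continuous_map_preimage[OF cont] U' V')+
  moreover have "A \<noteq> {}" "B \<noteq> {}"
    using m U V openin_subset unfolding A_def B_def by blast+
  moreover have "(g ^^ n) ` U \<inter> V \<noteq> {} \<and> (g ^^ n) ` U' \<inter> V' \<noteq> {}" if "(g ^^ n) ` A \<inter> B \<noteq> {}" for n
  proof -
    from that obtain x where x: "x \<in> A" "(g ^^ n) x \<in> B" by auto
    \<comment> \<open>The point \<open>x\<close> witnesses the pair \<open>(U, V)\<close>, and its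
      shift \<open>(g ^^ m) x\<close> witnesses \<open>(U', V')\<close>.\<close>
    have "(g ^^ n) ((g ^^ m) x) = (g ^^ m) ((g ^^ n) x)"
      by (metis add.commute comp_apply funpow_add)
    then have "(g ^^ n) ((g ^^ m) x) \<in> V'" "(g ^^ m) x \<in> U'" using x by (auto simp: A_def B_def)
    with x show ?thesis unfolding A_def B_def by blast
  qed
  ultimately show ?thesis by blast
qed

text \<open>The filter is generated by all hitting-time sets. They are directed by
  \<open>weakly_mixing_refine\<close> and each is non-empty, so the filter is proper.\<close>

lemma weakly_mixing_imp_adapted:
  assumes "weakly_mixing X g"
  shows "\<exists>F. F \<noteq> bot \<and> adapted_filter X g F"
proof -
  define I where "I = {(U, V). openin X U \<and> U \<noteq> {} \<and> openin X V \<and> V \<noteq> {}}"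
  define N where "N = (\<lambda>(U, V). {n. (g ^^ n) ` U \<inter> V \<noteq> {}})"
  define F where "F = (INF p\<in>I. principal (N p))"
  have "adapted_filter X g F"
    unfolding adapted_filter_def
  proof (intro allI impI)
    fix U V assume "openin X U \<and> U \<noteq> {} \<and> openin X V \<and> V \<noteq> {}"
    then have "(U, V) \<in> I" by (simp add: I_def)
    then show "\<forall>\<^sub>F n in F. (g ^^ n) ` U \<inter> V \<noteq> {}"
      unfolding F_def by (rule eventually_INF1) (simp add: eventually_principal N_def)
  qed
  moreover have "F \<noteq> bot"
  \<comment> \<open>If \<open>I\<close> is empty, there is no non-empty open set and
    \<open>F\<close> is the infimum of the empty family, that is \<open>top\<close>, which is proper
    on the natural numbers.\<close>
  proof (cases "I = {}")
    case False
    have "\<exists>p\<in>I. principal (N p) \<le> inf (principal (N a)) (principal (N b))"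
      if "a \<in> I" "b \<in> I" for a b
    proof -
      obtain U V U' V' where ab: "a = (U, V)" "b = (U', V')" by (metis surj_pair)
      have "\<exists>A B. openin X A \<and> A \<noteq> {} \<and> openin X B \<and> B \<noteq> {} \<and>
          (\<forall>n. (g ^^ n) ` A \<inter> B \<noteq> {} \<longrightarrow> (g ^^ n) ` U \<inter> V \<noteq> {} \<and> (g ^^ n) ` U' \<inter> V' \<noteq> {})"
        using that by (intro weakly_mixing_refine[OF assms]) (auto simp: ab I_def)
      then obtain A B where "openin X A" "A \<noteq> {}" "openin X B" "B \<noteq> {}"
        and AB: "\<And>n. (g ^^ n) ` A \<inter> B \<noteq> {} \<Longrightarrow>
          (g ^^ n) ` U \<inter> V \<noteq> {} \<and> (g ^^ n) ` U' \<inter> V' \<noteq> {}" by metis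
      then have "(A, B) \<in> I" by (simp add: I_def)
      moreover have "N (A, B) \<subseteq> N a \<inter> N b"
        using AB by (simp add: N_def ab subset_iff del: disjoint_iff image_is_empty)
      ultimately show ?thesis by (intro bexI[of _ "(A, B)"]) auto
    qed
    then have "eventually (\<lambda>n. False) F \<longleftrightarrow> (\<exists>p\<in>I. eventually (\<lambda>n. False) (principal (N p)))"
      unfolding F_def using False by (intro eventually_INF_base)
    moreover have "N p \<noteq> {}" if "p \<in> I" for p
    proof -
      obtain U V where p: "p = (U, V)" by (metis surj_pair)
      with that have "\<exists>n. (g ^^ n) ` U \<inter> V \<noteq> {} \<and> (g ^^ n) ` U \<inter> V \<noteq> {}"
        by (intro weakly_mixing_common_time[OF assms]) (auto simp: I_def)
      then show ?thesis by (auto simp: N_def p)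
    qed
    ultimately show ?thesis by (auto simp: trivial_limit_def eventually_principal)
  qed (simp add: F_def trivial_limit_def)
  ultimately show ?thesis by blast
qed

text \<open>Every non-empty open set of the product contains a non-empty open box. The two
  coordinate conditions hold eventually along \<open>F\<close>, hence jointly, and properness yields
  one \<open>n\<close> satisfying both.\<close>

lemma adapted_imp_weakly_mixing:
  assumes cont: "continuous_map X X g" and "F \<noteq> bot" and F: "adapted_filter X g F"
  shows "weakly_mixing X g"
  unfolding weakly_mixing_def topologically_transitive_def
proof (intro conjI allI impI)
  show "continuous_map (prod_topology X X) (prod_topology X X) (map_prod g g)"
    using continuous_map_prod_top[of X X X X g g] cont by (simp add: map_prod_def)
  fix U V assume UV: "openin (prod_topology X X) U \<and> U \<noteq> {} \<and> openin (prod_topology X X) V \<and> V \<noteq> {}"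
  have box: "\<exists>A B. openin X A \<and> A \<noteq> {} \<and> openin X B \<and> B \<noteq> {} \<and> A \<times> B \<subseteq> W"
    if "openin (prod_topology X X) W" "W \<noteq> {}" for W
  proof -
    from that(2) obtain x y where "(x, y) \<in> W" by fastforce
    then show ?thesis
      using that(1) unfolding openin_prod_topology_alt by (metis empty_iff)
  qed
  obtain A B where AB: "openin X A" "A \<noteq> {}" "openin X B" "B \<noteq> {}" "A \<times> B \<subseteq> U"
    using box UV by meson
  obtain A' B' where AB': "openin X A'" "A' \<noteq> {}" "openin X B'" "B' \<noteq> {}" "A' \<times> B' \<subseteq> V"
    using box UV by meson
  have "\<forall>\<^sub>F n in F. (g ^^ n) ` A \<inter> A' \<noteq> {} \<and> (g ^^ n) ` B \<inter> B' \<noteq> {}"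
    using F AB AB' unfolding adapted_filter_def by (intro eventually_conj) blast+
  then obtain n where n: "(g ^^ n) ` A \<inter> A' \<noteq> {}" "(g ^^ n) ` B \<inter> B' \<noteq> {}"
    using \<open>F \<noteq> bot\<close> eventually_happens' by blast
  then obtain a b where "a \<in> A" "(g ^^ n) a \<in> A'" "b \<in> B" "(g ^^ n) b \<in> B'" by blast
  then have "(a, b) \<in> U" "(map_prod g g ^^ n) (a, b) \<in> V"
    using AB AB' by (auto simp: funpow_map_prod)
  then show "\<exists>n. (map_prod g g ^^ n) ` U \<inter> V \<noteq> {}" by blast
qed (rule cont)

lemma weakly_mixing_imp_transitive:
  assumes "weakly_mixing X g" shows "topologically_transitive X g"
  unfolding topologically_transitive_def
proof (intro conjI allI impI)
  show "continuous_map X X g" using assms by (simp add: weakly_mixing_def)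
  fix U V assume "openin X U \<and> U \<noteq> {} \<and> openin X V \<and> V \<noteq> {}"
  then have "\<exists>n. (g ^^ n) ` U \<inter> V \<noteq> {} \<and> (g ^^ n) ` U \<inter> V \<noteq> {}"
    by (intro weakly_mixing_common_time[OF assms]) auto
  then show "\<exists>n. (g ^^ n) ` U \<inter> V \<noteq> {}" by simp
qed

section \<open>Common periods\<close>

lemma funpow_mult_fixed:
  assumes "(g ^^ m) x = x" shows "(g ^^ (m * k)) x = x"
  using assms by (induction k) (simp_all add: funpow_add)

lemma common_period:
  assumes "m \<ge> 1" "(g ^^ m) x = x" "n \<ge> 1" "(h ^^ n) y = y"
  shows "\<exists>k\<ge>1. (g ^^ k) x = x \<and> (h ^^ k) y = y"
  using assms funpow_mult_fixed[of m g x n] funpow_mult_fixed[of n h y m]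
  by (intro exI[of _ "m * n"]) (simp add: mult.commute)

section \<open>The Lipschitz-free space\<close>

lemma dual_norm_diff_triangle:
  assumes "\<Phi> \<in> Lip0_dual e" "\<Psi> \<in> Lip0_dual e" "\<Theta> \<in> Lip0_dual e"
  shows "dual_norm e (\<Phi> - \<Theta>) \<le> dual_norm e (\<Phi> - \<Psi>) + dual_norm e (\<Psi> - \<Theta>)"
  using dual_norm_add_le[of "\<Phi> - \<Psi>" e "\<Psi> - \<Theta>"] assms by (simp add: Lip0_dual_diff)

lemma dual_norm_add_diff:
  assumes "\<Phi> \<in> Lip0_dual e" "\<Psi> \<in> Lip0_dual e" "\<Phi>' \<in> Lip0_dual e" "\<Psi>' \<in> Lip0_dual e"
  shows "dual_norm e (\<Phi> + \<Psi> - (\<Phi>' + \<Psi>')) \<le> dual_norm e (\<Phi> - \<Phi>') + dual_norm e (\<Psi> - \<Psi>')"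
proof -
  have "\<Phi> + \<Psi> - (\<Phi>' + \<Psi>') = (\<Phi> - \<Phi>') + (\<Psi> - \<Psi>')" by (simp add: algebra_simps)
  then show ?thesis using assms by (simp only:) (intro dual_norm_add_le Lip0_dual_diff)
qed

lemma dual_norm_scale_diff:
  assumes "\<Phi> \<in> Lip0_dual e" "\<Psi> \<in> Lip0_dual e"
  shows "dual_norm e (fun_scale c \<Phi> - fun_scale c \<Psi>) \<le> norm c * dual_norm e (\<Phi> - \<Psi>)"
  using dual_norm_scale_le[OF Lip0_dual_diff[OF assms], of c]
  by (simp add: fun_module.scale_right_diff_distrib)

text \<open>Nearness in the metric space passes to the free space through this bound, which is the
  Lipschitz estimate for each test function.\<close>

lemma dual_norm_delta_diff: "dual_norm e (delta e x - delta e y) \<le> dist x y"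
proof (rule dual_norm_le)
  fix \<phi> :: "'a \<Rightarrow> 'b" assume \<phi>: "\<phi> \<in> Lip0 e"
  then have "dist (\<phi> x) (\<phi> y) \<le> lip_norm \<phi> * dist x y"
    using Lip0_lipschitz lipschitz_onD by blast
  with \<phi> show "norm ((delta e x - delta e y) \<phi>) \<le> dist x y * lip_norm \<phi>"
    by (simp add: delta_def dist_norm mult.commute)
qed simp

lemma dual_norm_diff_deltas_less:
  fixes e :: "'a::metric_space"
  assumes "dist x x' < r / 2" "dist y y' < r / 2"
  shows "dual_norm e (delta e x - delta e y - (delta e x' - delta e y')
    :: ('a \<Rightarrow> 'k::real_normed_field) \<Rightarrow> 'k) < r"
proof -
  let ?d = "delta e :: 'a \<Rightarrow> ('a \<Rightarrow> 'k) \<Rightarrow> 'k"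
  have *: "?d x - ?d y - (?d x' - ?d y') = (?d x - ?d x') + (?d y' - ?d y)"
    by (simp add: algebra_simps)
  have "dual_norm e (?d x - ?d y - (?d x' - ?d y'))
      \<le> dual_norm e (?d x - ?d x') + dual_norm e (?d y' - ?d y)"
    unfolding * by (intro dual_norm_add_le Lip0_dual_diff delta_in_dual)
  also have "\<dots> \<le> dist x x' + dist y' y" by (intro add_mono dual_norm_delta_diff)
  finally show ?thesis using assms by (simp add: dist_commute)
qed

lemma free_space_add: "\<Phi> \<in> free_space e \<Longrightarrow> \<Psi> \<in> free_space e \<Longrightarrow> \<Phi> + \<Psi> \<in> free_space e"
  and free_space_scale: "\<Phi> \<in> free_space e \<Longrightarrow> fun_scale c \<Phi> \<in> free_space e"
  and free_space_0: "0 \<in> free_space e"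
  using subspace_free_space[of e] unfolding fun_module.subspace_def by blast+

text \<open>The free space is the smallest closed subspace that contains all
  \<open>delta e x\<close>. No case for \<open>0\<close> appears because
  \<open>delta e e = 0\<close>.\<close>

lemma free_space_induct [consumes 1, case_names delta add scale closed]:
  assumes "\<Phi> \<in> free_space e"
    and delta: "\<And>x. P (delta e x)"
    and add: "\<And>\<Phi> \<Psi>. \<Phi> \<in> free_space e \<Longrightarrow> \<Psi> \<in> free_space e \<Longrightarrow> P \<Phi> \<Longrightarrow> P \<Psi> \<Longrightarrow> P (\<Phi> + \<Psi>)"
    and scale: "\<And>c \<Phi>. \<Phi> \<in> free_space e \<Longrightarrow> P \<Phi> \<Longrightarrow> P (fun_scale c \<Phi>)"
    and closed: "\<And>\<Phi>. \<Phi> \<in> free_space e \<Longrightarrow>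
      (\<And>r. r > 0 \<Longrightarrow> \<exists>\<Psi>\<in>free_space e. P \<Psi> \<and> dual_norm e (\<Phi> - \<Psi>) < r) \<Longrightarrow> P \<Phi>"
  shows "P \<Phi>"
proof -
  have span: "\<Psi> \<in> free_space e \<and> P \<Psi>" if "\<Psi> \<in> fun_module.span (range (delta e))" for \<Psi>
    using that
  proof (induction rule: fun_module.span_induct_alt)
    case base
    show ?case using delta[of e] delta_base free_space_0 by metis
  next
    case (step c x y)
    then have x: "x \<in> free_space e" "P x" using delta delta_free_space by auto
    with step show ?case by (intro conjI add scale free_space_add free_space_scale) simp_all
  qed
  show ?thesis
  proof (rule closed)
    fix r :: real assume "r > 0"
    then obtain \<Psi> where "\<Psi> \<in> fun_module.span (range (delta e))" "dual_norm e (\<Phi> - \<Psi>) < r"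
      using assms(1) unfolding free_space_iff by blast
    with span show "\<exists>\<Psi>\<in>free_space e. P \<Psi> \<and> dual_norm e (\<Phi> - \<Psi>) < r" by blast
  qed fact
qed

section \<open>Transfer to the operator\<close>

context
  fixes e :: "'a::metric_space" and f :: "'a \<Rightarrow> 'a"
    and C :: real and T :: "(('a \<Rightarrow> 'k::real_normed_field) \<Rightarrow> 'k) \<Rightarrow> (('a \<Rightarrow> 'k) \<Rightarrow> 'k)"
  assumes f: "C-lipschitz_on UNIV f"
    and T: "free_operator e T" and T_delta: "\<And>x. T (delta e x) = delta e (f x) - delta e (f e)"
begin

section \<open>Continuity and iterates of the operator\<close>

lemma continuous_free_operator: "continuous_map (free_topology e) (free_topology e) T"
proof -
  interpret Metric_space "free_space e :: (('a \<Rightarrow> 'k) \<Rightarrow> 'k) set" "dual_dist e"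
    by (rule Metric_space_free)
  have mem: "T \<Phi> \<in> free_space e" if "\<Phi> \<in> free_space e" for \<Phi>
    using T that by (auto simp: free_operator_def)
  obtain B where B: "B \<ge> 0" "\<And>\<Phi>. \<Phi> \<in> free_space e \<Longrightarrow> dual_norm e (T \<Phi>) \<le> B * dual_norm e \<Phi>"
    using free_operator_bound[OF f T] by blast
  show ?thesis
    unfolding free_topology_def metric_continuous_map[OF Metric_space_free]
  proof (intro conjI ballI allI impI)
    show "T ` free_space e \<subseteq> free_space e" using mem by blast
    fix \<Phi> :: "('a \<Rightarrow> 'k) \<Rightarrow> 'k" and r :: real assume \<Phi>: "\<Phi> \<in> free_space e" and "r > 0"
    \<comment> \<open>Adding 1 keeps the denominator positive when \<open>B = 0\<close> and makes
      \<open>B * s < r\<close> strict.\<close>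
    define s where "s = r / (B + 1)"
    have s: "s > 0" "B * s < r" using \<open>r > 0\<close> B(1) by (auto simp: s_def field_simps)
    show "\<exists>s>0. \<forall>\<Psi>. \<Psi> \<in> free_space e \<and> dual_dist e \<Phi> \<Psi> < s \<longrightarrow> dual_dist e (T \<Phi>) (T \<Psi>) < r"
    proof (intro exI[of _ s] conjI allI impI s)
      fix \<Psi> assume \<Psi>: "\<Psi> \<in> free_space e \<and> dual_dist e \<Phi> \<Psi> < s"
      have "dual_norm e (T \<Phi> - T \<Psi>) \<le> B * dual_norm e (\<Phi> - \<Psi>)"
        using B(2)[OF free_space_diff] \<Phi> \<Psi> by (metis free_operator_diff[OF f T])
      also have "\<dots> \<le> B * s"
        using B \<Phi> \<Psi> by (intro mult_left_mono) (auto simp: dual_dist_def free_space_dual)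
      also have "\<dots> < r" by (rule s)
      finally show "dual_dist e (T \<Phi>) (T \<Psi>) < r"
        using \<Phi> \<Psi> by (simp add: dual_dist_def mem free_space_dual)
    qed
  qed
qed

lemma funpow_free_space: "\<Phi> \<in> free_space e \<Longrightarrow> (T ^^ n) \<Phi> \<in> free_space e"
  using T by (induction n) (auto simp: free_operator_def)

lemma funpow_add_free_space:
  "\<Phi> \<in> free_space e \<Longrightarrow> \<Psi> \<in> free_space e \<Longrightarrow> (T ^^ n) (\<Phi> + \<Psi>) = (T ^^ n) \<Phi> + (T ^^ n) \<Psi>"
  using T by (induction n) (simp_all add: free_operator_def funpow_free_space)

lemma funpow_scale_free_space:
  "\<Phi> \<in> free_space e \<Longrightarrow> (T ^^ n) (fun_scale c \<Phi>) = fun_scale c ((T ^^ n) \<Phi>)"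
  using T by (induction n) (simp_all add: free_operator_def funpow_free_space)

text \<open>The correction term \<open>delta e (f e)\<close> cancels in differences, so there
  \<open>T\<close> simply follows \<open>f\<close>, even if \<open>f\<close> moves \<open>e\<close>.
  Hence the arguments below work with differences of evaluations.\<close>

lemma funpow_delta_diff:
  "(T ^^ n) (delta e x - delta e y) = delta e ((f ^^ n) x) - delta e ((f ^^ n) y)"
proof (induction n)
  case (Suc n)
  have "T (delta e u - delta e v) = delta e (f u) - delta e (f v)" for u v
    unfolding free_operator_diff[OF f T delta_free_space delta_free_space] T_delta
    by (simp add: fun_eq_iff)
  with Suc show ?case by (simp only: funpow.simps o_apply)
qed simp

section \<open>The closed subspace of linked pairs\<close>

definition linked :: "nat filter \<Rightarrow> (('a \<Rightarrow> 'k) \<Rightarrow> 'k) \<Rightarrow> (('a \<Rightarrow> 'k) \<Rightarrow> 'k) \<Rightarrow> bool" where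
  "linked F \<Phi> \<Psi> \<longleftrightarrow> (\<forall>r>0. \<forall>\<^sub>F n in F. \<exists>\<Theta>\<in>free_space e.
     dual_norm e (\<Theta> - \<Phi>) < r \<and> dual_norm e ((T ^^ n) \<Theta> - \<Psi>) < r)"

text \<open>Two eventual statements along a filter hold together, so both witnesses exist for the
  same \<open>n\<close>; their sum works because \<open>T ^^ n\<close> is additive.\<close>

lemma linked_add:
  assumes "linked F \<Phi> \<Psi>" "linked F \<Phi>' \<Psi>'"
    and mem: "\<Phi> \<in> free_space e" "\<Psi> \<in> free_space e" "\<Phi>' \<in> free_space e" "\<Psi>' \<in> free_space e"
  shows "linked F (\<Phi> + \<Phi>') (\<Psi> + \<Psi>')"
  unfolding linked_def
proof (intro allI impI)
  fix r :: real assume "r > 0"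
  then have "r / 2 > 0" by simp
  with assms(1,2) have "\<forall>\<^sub>F n in F. \<exists>\<Theta>\<in>free_space e.
      dual_norm e (\<Theta> - \<Phi>) < r / 2 \<and> dual_norm e ((T ^^ n) \<Theta> - \<Psi>) < r / 2"
    and "\<forall>\<^sub>F n in F. \<exists>\<Theta>\<in>free_space e.
      dual_norm e (\<Theta> - \<Phi>') < r / 2 \<and> dual_norm e ((T ^^ n) \<Theta> - \<Psi>') < r / 2"
    unfolding linked_def by blast+
  then show "\<forall>\<^sub>F n in F. \<exists>\<Theta>\<in>free_space e.
      dual_norm e (\<Theta> - (\<Phi> + \<Phi>')) < r \<and> dual_norm e ((T ^^ n) \<Theta> - (\<Psi> + \<Psi>')) < r"
  proof eventually_elim
    case (elim n)
    then obtain \<Theta> \<Theta>' where \<Theta>: "\<Theta> \<in> free_space e" "\<Theta>' \<in> free_space e"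
      and less: "dual_norm e (\<Theta> - \<Phi>) < r / 2" "dual_norm e ((T ^^ n) \<Theta> - \<Psi>) < r / 2"
        "dual_norm e (\<Theta>' - \<Phi>') < r / 2" "dual_norm e ((T ^^ n) \<Theta>' - \<Psi>') < r / 2"
      by blast
    have "dual_norm e (\<Theta> + \<Theta>' - (\<Phi> + \<Phi>')) \<le> dual_norm e (\<Theta> - \<Phi>) + dual_norm e (\<Theta>' - \<Phi>')"
      by (intro dual_norm_add_diff free_space_dual \<Theta> mem)
    moreover have "dual_norm e ((T ^^ n) (\<Theta> + \<Theta>') - (\<Psi> + \<Psi>'))
        \<le> dual_norm e ((T ^^ n) \<Theta> - \<Psi>) + dual_norm e ((T ^^ n) \<Theta>' - \<Psi>')"
      unfolding funpow_add_free_space[OF \<Theta>]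
      by (intro dual_norm_add_diff free_space_dual funpow_free_space \<Theta> mem)
    ultimately show ?case
      using less by (intro bexI[of _ "\<Theta> + \<Theta>'"] free_space_add \<Theta>) linarith
  qed
qed

lemma linked_scale:
  assumes "linked F \<Phi> \<Psi>" and mem: "\<Phi> \<in> free_space e" "\<Psi> \<in> free_space e"
  shows "linked F (fun_scale c \<Phi>) (fun_scale c \<Psi>)"
  unfolding linked_def
proof (intro allI impI)
  fix r :: real assume "r > 0"
  define s where "s = r / (norm c + 1)"
  have c1: "norm c + 1 > 0" by (rule add_nonneg_pos) auto
  have s: "s > 0" "norm c * s < r" using \<open>r > 0\<close> c1 by (auto simp: s_def field_simps)
  have less: "norm c * t < r" if "t < s" for t
    using s(2) mult_left_mono[of t s "norm c"] that by simp
  have "\<forall>\<^sub>F n in F. \<exists>\<Theta>\<in>free_space e.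
      dual_norm e (\<Theta> - \<Phi>) < s \<and> dual_norm e ((T ^^ n) \<Theta> - \<Psi>) < s"
    using assms(1) s(1) unfolding linked_def by blast
  then show "\<forall>\<^sub>F n in F. \<exists>\<Theta>\<in>free_space e.
      dual_norm e (\<Theta> - fun_scale c \<Phi>) < r \<and> dual_norm e ((T ^^ n) \<Theta> - fun_scale c \<Psi>) < r"
  proof eventually_elim
    case (elim n)
    then obtain \<Theta> where \<Theta>: "\<Theta> \<in> free_space e"
      "dual_norm e (\<Theta> - \<Phi>) < s" "dual_norm e ((T ^^ n) \<Theta> - \<Psi>) < s" by blast
    show ?case
    proof (intro bexI[of _ "fun_scale c \<Theta>"] conjI)
      show "dual_norm e (fun_scale c \<Theta> - fun_scale c \<Phi>) < r"
        using dual_norm_scale_diff less \<Theta> mem by (meson free_space_dual order_le_less_trans)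
      show "dual_norm e ((T ^^ n) (fun_scale c \<Theta>) - fun_scale c \<Psi>) < r"
        unfolding funpow_scale_free_space[OF \<Theta>(1)]
        using dual_norm_scale_diff less \<Theta> mem funpow_free_space
        by (meson free_space_dual order_le_less_trans)
    qed (intro free_space_scale \<Theta>)
  qed
qed

text \<open>The witness for a nearby linked pair is kept unchanged. The image of the witness stays
  the same and only its target moves, from \<open>\<Psi>'\<close> to \<open>\<Psi>\<close>, so the
  estimate is uniform in \<open>n\<close>.\<close>

lemma linked_closed:
  assumes mem: "\<Phi> \<in> free_space e" "\<Psi> \<in> free_space e"
    and approx: "\<And>r. r > 0 \<Longrightarrow> \<exists>\<Phi>'\<in>free_space e. \<exists>\<Psi>'\<in>free_space e. linked F \<Phi>' \<Psi>' \<and>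
      dual_norm e (\<Phi> - \<Phi>') < r \<and> dual_norm e (\<Psi> - \<Psi>') < r"
  shows "linked F \<Phi> \<Psi>"
  unfolding linked_def
proof (intro allI impI)
  fix r :: real assume "r > 0"
  then have r2: "r / 2 > 0" by simp
  obtain \<Phi>' \<Psi>' where mem': "\<Phi>' \<in> free_space e" "\<Psi>' \<in> free_space e" and "linked F \<Phi>' \<Psi>'"
    and near: "dual_norm e (\<Phi>' - \<Phi>) < r / 2" "dual_norm e (\<Psi>' - \<Psi>) < r / 2"
    using approx[OF r2] dual_norm_minus_commute by metis
  then have "\<forall>\<^sub>F n in F. \<exists>\<Theta>\<in>free_space e.
      dual_norm e (\<Theta> - \<Phi>') < r / 2 \<and> dual_norm e ((T ^^ n) \<Theta> - \<Psi>') < r / 2"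
    using r2 unfolding linked_def by blast
  then show "\<forall>\<^sub>F n in F. \<exists>\<Theta>\<in>free_space e.
      dual_norm e (\<Theta> - \<Phi>) < r \<and> dual_norm e ((T ^^ n) \<Theta> - \<Psi>) < r"
  proof eventually_elim
    case (elim n)
    then obtain \<Theta> where \<Theta>: "\<Theta> \<in> free_space e"
      "dual_norm e (\<Theta> - \<Phi>') < r / 2" "dual_norm e ((T ^^ n) \<Theta> - \<Psi>') < r / 2" by blast
    have "dual_norm e (\<Theta> - \<Phi>) \<le> dual_norm e (\<Theta> - \<Phi>') + dual_norm e (\<Phi>' - \<Phi>)"
      "dual_norm e ((T ^^ n) \<Theta> - \<Psi>) \<le> dual_norm e ((T ^^ n) \<Theta> - \<Psi>') + dual_norm e (\<Psi>' - \<Psi>)"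
      by (intro dual_norm_diff_triangle free_space_dual funpow_free_space \<Theta> mem mem')+
    with \<Theta> near show ?case by (intro bexI[of _ \<Theta>]) linarith
  qed
qed

text \<open>At one time \<open>n\<close>, some \<open>z\<close> near \<open>x\<close> goes near
  \<open>y\<close> and some \<open>z'\<close> near \<open>x'\<close> goes near \<open>y'\<close>;
  the witness is \<open>delta e z - delta e z'\<close>. Choosing some of the four points equal to
  \<open>e\<close> makes one side vanish.\<close>

lemma linked_delta:
  assumes F: "adapted_filter euclidean f F"
  shows "linked F (delta e x - delta e x') (delta e y - delta e y')"
  unfolding linked_def
proof (intro allI impI)
  fix r :: real assume "r > 0"
  have "\<forall>\<^sub>F n in F. (f ^^ n) ` ball x (r / 2) \<inter> ball y (r / 2) \<noteq> {}"
    "\<forall>\<^sub>F n in F. (f ^^ n) ` ball x' (r / 2) \<inter> ball y' (r / 2) \<noteq> {}"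
    using F \<open>r > 0\<close> unfolding adapted_filter_def by (simp_all del: disjoint_iff)
  then show "\<forall>\<^sub>F n in F. \<exists>\<Theta>\<in>free_space e. dual_norm e (\<Theta> - (delta e x - delta e x')) < r
      \<and> dual_norm e ((T ^^ n) \<Theta> - (delta e y - delta e y')) < r"
  proof eventually_elim
    case (elim n)
    then obtain z z' where "dist z x < r / 2" "dist ((f ^^ n) z) y < r / 2"
      "dist z' x' < r / 2" "dist ((f ^^ n) z') y' < r / 2"
      by (auto simp: dist_commute)
    then show ?case
      by (intro bexI[of _ "delta e z - delta e z'"])
        (simp_all add: dual_norm_diff_deltas_less funpow_delta_diff free_space_diff delta_free_space)
  qed
qed

text \<open>By linearity and closedness it suffices to treat evaluations with the other coordinate
  \<open>0\<close>; then \<open>(\<Phi>, \<Psi>)\<close> is the sum of \<open>(\<Phi>, 0)\<close>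
  and \<open>(0, \<Psi>)\<close>.\<close>

lemma linked_all:
  assumes F: "adapted_filter euclidean f F" and "\<Phi> \<in> free_space e" "\<Psi> \<in> free_space e"
  shows "linked F \<Phi> \<Psi>"
proof -
  have "linked F \<Phi> 0"
    using assms(2)
  proof (induction rule: free_space_induct)
    case (delta x)
    then show ?case using linked_delta[OF F, of x e e e] by (simp only: delta_base diff_0_right)
  next
    case (add \<Phi> \<Psi>)
    then show ?case using linked_add[of F \<Phi> 0 \<Psi> 0] by (simp only: add_0_right free_space_0)
  next
    case (scale c \<Phi>)
    then show ?case using linked_scale[of F \<Phi> 0 c] by (simp only: fun_module.scale_zero_right free_space_0)
  next
    case (closed \<Phi>)
    show ?case
    proof (rule linked_closed)
      fix r :: real assume "r > 0"
      \<comment> \<open>Only the first coordinate is approximated; the second approximant is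
        \<open>0\<close> itself, at distance \<open>0\<close>.\<close>
      then show "\<exists>\<Phi>'\<in>free_space e. \<exists>\<Psi>'\<in>free_space e. linked F \<Phi>' \<Psi>' \<and>
          dual_norm e (\<Phi> - \<Phi>') < r \<and> dual_norm e (0 - \<Psi>') < r"
        using closed(2)[of r] by (metis free_space_0 dual_norm_0 diff_self)
    qed (rule closed free_space_0)+
  qed
  moreover have "linked F 0 \<Psi>"
    using assms(3)
  proof (induction rule: free_space_induct)
    case (delta x)
    then show ?case using linked_delta[OF F, of e e x e] by (simp only: delta_base diff_0_right)
  next
    case (add \<Phi> \<Psi>)
    then show ?case using linked_add[of F 0 \<Phi> 0 \<Psi>] by (simp only: add_0_right free_space_0)
  next
    case (scale c \<Phi>)
    then show ?case using linked_scale[of F 0 \<Phi> c] by (simp only: fun_module.scale_zero_right free_space_0)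
  next
    case (closed \<Phi>)
    show ?case
    proof (rule linked_closed)
      fix r :: real assume "r > 0"
      then show "\<exists>\<Phi>'\<in>free_space e. \<exists>\<Psi>'\<in>free_space e. linked F \<Phi>' \<Psi>' \<and>
          dual_norm e (0 - \<Phi>') < r \<and> dual_norm e (\<Phi> - \<Psi>') < r"
        using closed(2)[of r] by (metis free_space_0 dual_norm_0 diff_self)
    qed (rule closed free_space_0)+
  qed
  ultimately show ?thesis
    using linked_add[of F \<Phi> 0 0 \<Psi>] assms by (simp only: add_0_right add_0_left free_space_0)
qed

section \<open>Adapted filters, weak mixing and mixing for the operator\<close>

lemma adapted_free_operator:
  assumes F: "adapted_filter euclidean f F"
  shows "adapted_filter (free_topology e) T F"
  unfolding adapted_filter_def
proof (intro allI impI)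
  fix U V :: "(('a \<Rightarrow> 'k) \<Rightarrow> 'k) set"
  assume UV: "openin (free_topology e) U \<and> U \<noteq> {} \<and> openin (free_topology e) V \<and> V \<noteq> {}"
  interpret Metric_space "free_space e :: (('a \<Rightarrow> 'k) \<Rightarrow> 'k) set" "dual_dist e"
    by (rule Metric_space_free)
  have nbhd: "\<exists>\<Phi>\<in>free_space e. \<exists>r>0. \<forall>\<Theta>\<in>free_space e. dual_norm e (\<Theta> - \<Phi>) < r \<longrightarrow> \<Theta> \<in> W"
    if "openin (free_topology e) W" "W \<noteq> {}" for W :: "(('a \<Rightarrow> 'k) \<Rightarrow> 'k) set"
  proof -
    from that(2) obtain \<Phi> where \<Phi>: "\<Phi> \<in> W" by blast
    with that(1) obtain r where "r > 0" "\<Phi> \<in> free_space e" "mball \<Phi> r \<subseteq> W"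
      unfolding free_topology_def openin_mtopology by blast
    then show ?thesis
      by (intro bexI[of _ \<Phi>] exI[of _ r])
        (auto simp: subset_iff dual_dist_def free_space_dual dual_norm_minus_commute[of e \<Phi>])
  qed
  obtain \<Phi> r where \<Phi>: "\<Phi> \<in> free_space e" "r > 0"
      "\<And>\<Theta>. \<Theta> \<in> free_space e \<Longrightarrow> dual_norm e (\<Theta> - \<Phi>) < r \<Longrightarrow> \<Theta> \<in> U"
    using nbhd[of U] UV by blast
  obtain \<Psi> s where \<Psi>: "\<Psi> \<in> free_space e" "s > 0"
      "\<And>\<Theta>. \<Theta> \<in> free_space e \<Longrightarrow> dual_norm e (\<Theta> - \<Psi>) < s \<Longrightarrow> \<Theta> \<in> V"
    using nbhd[of V] UV by blast
  \<comment> \<open>The definition of \<open>linked\<close> has a single radius for source and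
    target, so the smaller of the two radii is taken.\<close>
  have "min r s > 0" using \<Phi> \<Psi> by simp
  then have "\<forall>\<^sub>F n in F. \<exists>\<Theta>\<in>free_space e.
      dual_norm e (\<Theta> - \<Phi>) < min r s \<and> dual_norm e ((T ^^ n) \<Theta> - \<Psi>) < min r s"
    using linked_all[OF F \<Phi>(1) \<Psi>(1)] unfolding linked_def by blast
  then show "\<forall>\<^sub>F n in F. (T ^^ n) ` U \<inter> V \<noteq> {}"
  proof eventually_elim
    case (elim n)
    then obtain \<Theta> where \<Theta>: "\<Theta> \<in> free_space e"
      "dual_norm e (\<Theta> - \<Phi>) < r" "dual_norm e ((T ^^ n) \<Theta> - \<Psi>) < s" by auto
    then have "\<Theta> \<in> U" "(T ^^ n) \<Theta> \<in> V" using \<Phi>(3) \<Psi>(3) funpow_free_space by blast+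
    then show ?case by blast
  qed
qed

lemma weakly_mixing_free_operator:
  assumes "weakly_mixing euclidean f" shows "weakly_mixing (free_topology e) T"
  using weakly_mixing_imp_adapted[OF assms] adapted_free_operator
    adapted_imp_weakly_mixing[OF continuous_free_operator] by blast

lemma mixing_free_operator:
  assumes "mixing euclidean f" shows "mixing (free_topology e) T"
  using assms adapted_free_operator continuous_free_operator unfolding mixing_iff_adapted by blast

section \<open>Periodic points of the operator\<close>

lemma topspace_free_topology: "topspace (free_topology e) = free_space e"
  unfolding free_topology_def by (rule Metric_space.topspace_mtopology[OF Metric_space_free])

lemma periodic_add:
  assumes "\<Phi> \<in> periodic_points (free_topology e) T" "\<Psi> \<in> periodic_points (free_topology e) T"
  shows "\<Phi> + \<Psi> \<in> periodic_points (free_topology e) T"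
proof -
  obtain k where "k \<ge> 1" "(T ^^ k) \<Phi> = \<Phi>" "(T ^^ k) \<Psi> = \<Psi>"
    using assms common_period[of _ T \<Phi> _ T \<Psi>] unfolding periodic_points_def by blast
  then show ?thesis
    using assms unfolding periodic_points_def topspace_free_topology
    by (auto simp: funpow_add_free_space free_space_add)
qed

lemma periodic_scale:
  assumes "\<Phi> \<in> periodic_points (free_topology e) T"
  shows "fun_scale c \<Phi> \<in> periodic_points (free_topology e) T"
  using assms unfolding periodic_points_def topspace_free_topology
  by (auto simp: funpow_scale_free_space free_space_scale)

text \<open>A difference is taken because for a period \<open>k\<close> of \<open>p\<close> the
  functional \<open>delta e p\<close> alone goes to \<open>delta e p - delta e ((f ^^ k) e)\<close>;
  subtracting \<open>delta e q\<close> cancels the extra term at a common period.\<close>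

lemma periodic_delta_diff:
  assumes "p \<in> periodic_points euclidean f" "q \<in> periodic_points euclidean f"
  shows "delta e p - delta e q \<in> periodic_points (free_topology e) T"
proof -
  obtain k where "k \<ge> 1" "(f ^^ k) p = p" "(f ^^ k) q = q"
    using assms common_period[of _ f p _ f q] unfolding periodic_points_def by blast
  then show ?thesis
    unfolding periodic_points_def topspace_free_topology
    by (auto simp: funpow_delta_diff free_space_diff delta_free_space)
qed

lemma periodic_free_space: "\<Phi> \<in> periodic_points (free_topology e) T \<Longrightarrow> \<Phi> \<in> free_space e"
  by (simp add: periodic_points_def topspace_free_topology)

lemma dense_periodic_free_operator:
  assumes dense: "euclidean closure_of periodic_points euclidean f = UNIV"
    and "\<Phi> \<in> free_space e" and "r > 0"
  shows "\<exists>\<Psi>\<in>periodic_points (free_topology e) T. dual_norm e (\<Phi> - \<Psi>) < r"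
  using assms(2,3)
proof (induction arbitrary: r rule: free_space_induct)
  case (delta x)
  \<comment> \<open>Used for \<open>z = x\<close> and for \<open>z = e\<close>: the base point may
    fail to be periodic, so it too is replaced by a nearby periodic point.\<close>
  have "\<exists>p\<in>periodic_points euclidean f. dist p z < r / 2" for z
    using dense closure_approachable[of z "periodic_points euclidean f"] half_gt_zero[OF delta]
    by (simp del: half_gt_zero_iff less_divide_eq_numeral1)
  then obtain p q where pq: "p \<in> periodic_points euclidean f" "q \<in> periodic_points euclidean f"
    "dist x p < r / 2" "dist e q < r / 2" by (metis dist_commute)
  have "dual_norm e (delta e x - (delta e p - delta e q)) < r"
    using dual_norm_diff_deltas_less[OF pq(3,4), of e] by (simp add: delta_base)
  then show ?case using periodic_delta_diff pq by blast
next
  case (add \<Phi> \<Psi>)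
  then obtain \<Phi>' \<Psi>' where *:
    "\<Phi>' \<in> periodic_points (free_topology e) T" "dual_norm e (\<Phi> - \<Phi>') < r / 2"
    "\<Psi>' \<in> periodic_points (free_topology e) T" "dual_norm e (\<Psi> - \<Psi>') < r / 2"
    by (meson half_gt_zero)
  have "dual_norm e (\<Phi> + \<Psi> - (\<Phi>' + \<Psi>')) \<le> dual_norm e (\<Phi> - \<Phi>') + dual_norm e (\<Psi> - \<Psi>')"
    by (intro dual_norm_add_diff free_space_dual add * periodic_free_space)
  with * show ?case by (intro bexI[of _ "\<Phi>' + \<Psi>'"] periodic_add) linarith
next
  case (scale c \<Phi>)
  define s where "s = r / (norm c + 1)"
  have c1: "norm c + 1 > 0" by (rule add_nonneg_pos) auto
  have s: "s > 0" "norm c * s < r" using \<open>r > 0\<close> c1 by (auto simp: s_def field_simps)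
  obtain \<Psi> where \<Psi>: "\<Psi> \<in> periodic_points (free_topology e) T" "dual_norm e (\<Phi> - \<Psi>) < s"
    using scale.IH s by blast
  have "dual_norm e (fun_scale c \<Phi> - fun_scale c \<Psi>) \<le> norm c * dual_norm e (\<Phi> - \<Psi>)"
    by (intro dual_norm_scale_diff free_space_dual scale \<Psi> periodic_free_space)
  also have "\<dots> \<le> norm c * s" using \<Psi> by (intro mult_left_mono) auto
  finally show ?case
    using s \<Psi> by (intro bexI[of _ "fun_scale c \<Psi>"] periodic_scale) (rule order_le_less_trans)
next
  case (closed \<Phi>)
  then obtain \<Psi> \<Theta> where *: "\<Psi> \<in> free_space e" "dual_norm e (\<Phi> - \<Psi>) < r / 2"
    "\<Theta> \<in> periodic_points (free_topology e) T" "dual_norm e (\<Psi> - \<Theta>) < r / 2"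
    by (meson half_gt_zero)
  have "dual_norm e (\<Phi> - \<Theta>) \<le> dual_norm e (\<Phi> - \<Psi>) + dual_norm e (\<Psi> - \<Theta>)"
    by (intro dual_norm_diff_triangle free_space_dual closed * periodic_free_space)
  with * show ?case by (intro bexI[of _ \<Theta>]) linarith+
qed

text \<open>Transitivity comes from weak mixing of \<open>T\<close>, and density of its periodic
  points from density of those of \<open>f\<close>.\<close>

lemma chaotic_free_operator:
  assumes "weakly_mixing euclidean f" "chaotic euclidean f"
  shows "chaotic (free_topology e) T"
  unfolding chaotic_def
proof
  show "topologically_transitive (free_topology e) T"
    by (intro weakly_mixing_imp_transitive weakly_mixing_free_operator assms)
  interpret Metric_space "free_space e :: (('a \<Rightarrow> 'k) \<Rightarrow> 'k) set" "dual_dist e"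
    by (rule Metric_space_free)
  have "euclidean closure_of periodic_points euclidean f = UNIV"
    using assms(2) by (simp add: chaotic_def)
  note dense = dense_periodic_free_operator[OF this]
  show "free_topology e closure_of periodic_points (free_topology e) T = topspace (free_topology e)"
    unfolding topspace_free_topology
    \<comment> \<open>Only the topology in which the closure is taken is unfolded to its metric; the
      one inside \<open>periodic_points\<close> stays folded to match \<open>dense\<close>.\<close>
    by (subst (1) free_topology_def, subst metric_closure_of)
      (use dense in \<open>fastforce simp: dual_dist_def free_space_dual periodic_free_space\<close>)
qed

end

theorem proposition5p8:
  fixes f :: "'a::metric_space \<Rightarrow> 'a" and e :: 'a
  assumes "infinite (UNIV :: 'a set)"
    and "\<exists>C. C-lipschitz_on UNIV f"
  shows
    "(weakly_mixing euclidean f \<longrightarrow>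
        weakly_mixing (free_topology e) (Lip_operator f e :: (('a \<Rightarrow> real) \<Rightarrow> real) \<Rightarrow> _) \<and>
        weakly_mixing (free_topology e) (Lip_operator f e :: (('a \<Rightarrow> complex) \<Rightarrow> complex) \<Rightarrow> _)) \<and>
     (mixing euclidean f \<longrightarrow>
        mixing (free_topology e) (Lip_operator f e :: (('a \<Rightarrow> real) \<Rightarrow> real) \<Rightarrow> _) \<and>
        mixing (free_topology e) (Lip_operator f e :: (('a \<Rightarrow> complex) \<Rightarrow> complex) \<Rightarrow> _)) \<and>
     (weakly_mixing euclidean f \<and> chaotic euclidean f \<longrightarrow>
        (weakly_mixing (free_topology e) (Lip_operator f e :: (('a \<Rightarrow> real) \<Rightarrow> real) \<Rightarrow> _) \<and>
         chaotic (free_topology e) (Lip_operator f e :: (('a \<Rightarrow> real) \<Rightarrow> real) \<Rightarrow> _)) \<and>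
        (weakly_mixing (free_topology e) (Lip_operator f e :: (('a \<Rightarrow> complex) \<Rightarrow> complex) \<Rightarrow> _) \<and>
         chaotic (free_topology e) (Lip_operator f e :: (('a \<Rightarrow> complex) \<Rightarrow> complex) \<Rightarrow> _)))"
proof -
  obtain C where f: "C-lipschitz_on UNIV f" using assms(2) by blast
  \<comment> \<open>The scalar field stays schematic in these facts, so the same rules settle the
    real and the complex goals.\<close>
  note T = Lip_operator_spec[OF f, THEN conjunct1] Lip_operator_spec[OF f, THEN conjunct2, THEN spec]
  show ?thesis
    by (intro conjI impI weakly_mixing_free_operator[OF f T] mixing_free_operator[OF f T]
        chaotic_free_operator[OF f T]) auto
qed

end
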